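(* Let $k\ge 0$ be an integer and let $n$ be an integer with $3\cdot 2^k \le n \le 3\cdot 2^{k+1}$. Then the minimum of the total chord length $TCL(G)$ over all maximal outerplanar graphs $G$ of order $n$ equals \[ n(k+2)-3\cdot 2^{k+1}. \]
   Context: A maximal outerplanar graph of order $n$ is regarded as a drawing consisting of an $n$-cycle $\mathcal{C}$ in the plane together with a triangulation (by non-crossing straight edges between vertices of $\mathcal{C}$) of the bounded region determined by $\mathcal{C}$; all $n$ vertices lie on $\mathcal{C}$. The edges not belonging to $\mathcal{C}$ are called chords (there are $n-3$ of them). The length of a chord is the length (number of edges) of a shortest path in $\mathcal{C}$ between its endpoints. The total chord length $TCL(G)$ is the sum of the lengths of all chords of $G$. *)

theory Defs
  imports "HOL-Analysis.Analysis"
begin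

text \<open>
  The vertices are \<open>0, \<dots>, n - 1\<close>, numbered along the cycle; an edge is an unordered
  pair of vertices, encoded as a two-element set.
\<close>

definition cycle_edges :: "nat \<Rightarrow> nat set set" where
  "cycle_edges n = {{i, Suc i mod n} | i. i < n}"

definition cycle_path :: "nat \<Rightarrow> nat list \<Rightarrow> bool" where
  "cycle_path n xs \<longleftrightarrow> xs \<noteq> [] \<and> set xs \<subseteq> {..<n} \<and> distinct xs \<and>
     (\<forall>m. Suc m < length xs \<longrightarrow> {xs ! m, xs ! Suc m} \<in> cycle_edges n)"

definition chord_length :: "nat \<Rightarrow> nat set \<Rightarrow> nat" where
  "chord_length n e = (LEAST l. \<exists>xs. cycle_path n xs \<and> {hd xs, last xs} = e \<and> length xs = Suc l)"

definition TCL :: "nat \<Rightarrow> nat set set \<Rightarrow> nat" where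
  "TCL n D = (\<Sum>e\<in>D. chord_length n e)"

text \<open>If \<open>e = {i, j}\<close>, this is the closed segment from \<open>p i\<close> to \<open>p j\<close>.\<close>

definition edge_segment :: "(nat \<Rightarrow> complex) \<Rightarrow> nat set \<Rightarrow> complex set" where
  "edge_segment p e = convex hull (p ` e)"

definition straight_line_drawing :: "nat \<Rightarrow> (nat \<Rightarrow> complex) \<Rightarrow> nat set set \<Rightarrow> bool" where
  "straight_line_drawing n p E \<longleftrightarrow> inj_on p {..<n} \<and>
     (\<forall>e\<in>E. \<forall>f\<in>E. e \<noteq> f \<longrightarrow> edge_segment p e \<inter> edge_segment p f = p ` (e \<inter> f))"

definition cycle_region :: "nat \<Rightarrow> (nat \<Rightarrow> complex) \<Rightarrow> complex set" where
  "cycle_region n p = inside (\<Union>e\<in>cycle_edges n. edge_segment p e)"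

text \<open>
  The polygon need not be convex, and consecutive vertices may be collinear.  For the latter
  reason the sides of a triangular face are required to be edges of the graph: otherwise a
  triangle with an additional vertex in the middle of a side would count as triangulated.
\<close>

definition maximal_outerplanar :: "nat \<Rightarrow> (nat \<Rightarrow> complex) \<Rightarrow> nat set set \<Rightarrow> bool" where
  "maximal_outerplanar n p D \<longleftrightarrow> 3 \<le> n \<and>
     (\<forall>e\<in>D. e \<subseteq> {..<n} \<and> card e = 2 \<and> e \<notin> cycle_edges n) \<and>
     straight_line_drawing n p (cycle_edges n \<union> D) \<and>
     (\<forall>e\<in>D. edge_segment p e - p ` e \<subseteq> cycle_region n p) \<and>
     (\<forall>R \<in> components (cycle_region n p - (\<Union>e\<in>D. edge_segment p e)).
        \<exists>a b c. {{a, b}, {b, c}, {a, c}} \<subseteq> cycle_edges n \<union> D \<and>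
          R = interior (convex hull {p a, p b, p c}))"

end

theory Submission
  imports Defs "HOL-Library.Sublist"
begin

text \<open>
  A chord of a triangulated polygon cuts it, by the theta-curve lemma
  \<open>split_inside_simple_closed_curve\<close>, into two smaller triangulated polygons. So the drawings of
  maximal outerplanar graphs yield exactly the combinatorial triangulations of a cyclic list of
  vertices; conversely every triangulation is realised by points on a parabola.

  Lower bound: let \<open>f s\<close> be the least total size of all nodes in a binary tree with \<open>s\<close> leaves;
  it dominates each of the lines \<open>s (q + 3) - 2 ^ (q + 1)\<close>. Three such trees hang off a triangle
  whose sides cut off arcs \<open>x + y + z = n\<close> of length at most \<open>n / 2\<close>, so that taking \<open>q = k\<close> bounds the
  total length of all edges, those of the cycle included, by \<open>n (k + 3) - 3 * 2 ^ (k + 1)\<close> from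
  below. Instead of locating this central triangle, the proof assigns weights to arcs that make the
  bound additive under cutting along a chord. Upper bound: three balanced trees.
\<close>

section \<open>Polygons as cyclic lists\<close>

text \<open>The weights are forced. A polygon obtained by cutting need not look like a tree hanging
  off a short side, so the induction needs a bound that treats all sides alike: \<open>c\<close>
  minus a correction \<open>\<phi> (gap n u v) - L {u, v}\<close> for each side. Gluing two polygons
  along a chord with arcs \<open>x\<close> and \<open>n - x\<close> preserves it exactly when
  \<open>\<phi> x + \<phi> (n - x)\<close> is \<open>c\<close> plus the chord's length. With
  \<open>tree_cost\<close> as \<open>\<phi>\<close> below \<open>n / 2\<close>, this determines
  \<open>\<phi>\<close> everywhere; what remains to check is one inequality for a single triangle.
  The lines arise by recursion: a root with \<open>s\<close> leaves adds \<open>s\<close> to two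
  bounds, which raises the slope by one and doubles the constant, beginning with
  \<open>3 * s - 2\<close>. The line for \<open>q\<close> is attained on
  \<open>2 ^ q \<le> s \<le> 2 ^ (q + 1)\<close>, and the range of \<open>n\<close> puts three
  nearly equal arcs into this interval for \<open>q = k\<close>. On the geometric side, a face is
  only known to be the interior of some triangle with edges of the graph as sides. Cutting must
  therefore show that these sides belong to the same half as the face.\<close>

fun path_edges :: "'a list \<Rightarrow> 'a set set" where
  "path_edges (x # y # zs) = insert {x, y} (path_edges (y # zs))"
| "path_edges _ = {}"

text \<open>Edges are sets, so a digon \<open>[a, b]\<close> has the single edge
  \<open>{a, b}\<close>, although the closed walk traverses it twice.\<close>

definition closed_edges :: "'a list \<Rightarrow> 'a set set" where
  "closed_edges vs = path_edges (vs @ [hd vs])"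

lemma path_edges_append: "path_edges (xs @ y # ys) = path_edges (xs @ [y]) \<union> path_edges (y # ys)"
proof (induction xs rule: path_edges.induct)
  case (1 x y zs) then show ?case by auto
next
  case "2_1" then show ?case by simp
next
  case ("2_2" x) then show ?case by (cases ys) auto
qed

lemma path_edges_subset: "e \<in> path_edges xs \<Longrightarrow> e \<subseteq> set xs"
  by (induction xs rule: path_edges.induct) auto

lemma path_edges_card: "distinct xs \<Longrightarrow> e \<in> path_edges xs \<Longrightarrow> card e = 2"
  by (induction xs rule: path_edges.induct) auto

lemma finite_path_edges [simp]: "finite (path_edges xs)"
  by (induction xs rule: path_edges.induct) auto

lemma finite_closed_edges [simp]: "finite (closed_edges vs)"
  by (simp add: closed_edges_def)

lemma path_edges_Cons:
  "ys \<noteq> [] \<Longrightarrow> path_edges (x # ys) = insert {x, hd ys} (path_edges ys)"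
  by (cases ys) auto

lemma path_edges_snoc:
  "xs \<noteq> [] \<Longrightarrow> path_edges (xs @ [y]) = insert {last xs, y} (path_edges xs)"
  by (induction xs rule: path_edges.induct) auto

lemma closed_edges_rotate: "closed_edges (xs @ ys) = closed_edges (ys @ xs)"
proof (cases "xs = [] \<or> ys = []")
  case False
  then obtain x xs' y ys' where [simp]: "xs = x # xs'" "ys = y # ys'"
    by (meson list.exhaust)
  show ?thesis
    using path_edges_append[of xs y "ys' @ [x]"] path_edges_append[of ys x "xs' @ [y]"]
    by (auto simp: closed_edges_def)
qed auto

lemma closed_edges_split:
  "closed_edges (a # B @ b # C) = path_edges (a # B @ [b]) \<union> path_edges (b # C @ [a])"
  using path_edges_append[of "a # B" b "C @ [a]"] by (simp add: closed_edges_def)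

lemma closed_edges_arc: "closed_edges (a # B @ [b]) = insert {a, b} (path_edges (a # B @ [b]))"
  using path_edges_append[of "a # B" b "[a]"] by (auto simp: closed_edges_def)

lemma ends_notin_path_edges:
  assumes "distinct (a # B @ [b])" "B \<noteq> []" shows "{a, b} \<notin> path_edges (a # B @ [b])"
proof -
  obtain y B' where B: "B = y # B'" using assms(2) by (meson list.exhaust)
  have "a \<notin> set (B @ [b])" "y \<noteq> b" using assms B by auto
  then show ?thesis using path_edges_subset[of "{a,b}" "B @ [b]"] B
    by (auto simp: doubleton_eq_iff)
qed

lemma closed_edges_subset: "e \<in> closed_edges vs \<Longrightarrow> e \<subseteq> set vs"
  unfolding closed_edges_def by (cases vs) (auto dest!: path_edges_subset)

lemma closed_edges_card:
  assumes "distinct vs" "2 \<le> length vs" "e \<in> closed_edges vs" shows "card e = 2"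
proof -
  obtain a w where vs: "vs = a # w" "w \<noteq> []" using assms(2) by (cases vs; cases "tl vs") auto
  obtain B b where w: "w = B @ [b]" using vs(2) by (meson rev_exhaust)
  show ?thesis using assms closed_edges_arc[of a B b] path_edges_card[of "a # B @ [b]" e]
    by (auto simp: vs w)
qed

section \<open>Drawn polygons as arcs and closed curves; cutting along a chord\<close>

definition segs :: "('a \<Rightarrow> complex) \<Rightarrow> 'a set set \<Rightarrow> complex set" where
  "segs p E = (\<Union>e\<in>E. convex hull (p ` e))"

text \<open>The vertex set is a parameter, unlike in \<open>straight_line_drawing\<close>, so that
  subpolygons inherit the property by \<open>plane_drawing_mono\<close>.\<close>

definition plane_drawing :: "('a \<Rightarrow> complex) \<Rightarrow> 'a set \<Rightarrow> 'a set set \<Rightarrow> bool" where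
  "plane_drawing p V E \<longleftrightarrow> inj_on p V \<and>
     (\<forall>e\<in>E. \<forall>f\<in>E. e \<noteq> f \<longrightarrow> convex hull (p ` e) \<inter> convex hull (p ` f) = p ` (e \<inter> f))"

lemma segs_Un: "segs p (E \<union> F) = segs p E \<union> segs p F"
  by (auto simp: segs_def)

lemma segs_insert: "segs p (insert e F) = convex hull (p ` e) \<union> segs p F"
  by (auto simp: segs_def)

lemma segs_mono: "E \<subseteq> F \<Longrightarrow> segs p E \<subseteq> segs p F"
  by (auto simp: segs_def)

lemma plane_drawing_mono:
  "plane_drawing p V E \<Longrightarrow> W \<subseteq> V \<Longrightarrow> F \<subseteq> E \<Longrightarrow> plane_drawing p W F"
  unfolding plane_drawing_def by (meson inj_on_subset subsetD)

lemma plane_drawingD: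
  "plane_drawing p V E \<Longrightarrow> e \<in> E \<Longrightarrow> f \<in> E \<Longrightarrow> e \<noteq> f \<Longrightarrow>
   convex hull (p ` e) \<inter> convex hull (p ` f) = p ` (e \<inter> f)"
  by (simp add: plane_drawing_def)

lemma compact_segs:
  assumes "finite E" "\<And>e. e \<in> E \<Longrightarrow> finite e" shows "compact (segs p E)"
  unfolding segs_def using assms
  by (intro compact_UN compact_convex_hull finite_imp_compact finite_imageI) auto

text \<open>Each new segment is joined in front of an arc. As its first vertex does not recur, the
  drawing condition lets it meet the rest only at the joint.\<close>

lemma path_edges_arc:
  assumes "distinct xs" "2 \<le> length xs" "plane_drawing p (set xs) (path_edges xs)"
  obtains g where "arc g" "pathstart g = p (hd xs)" "pathfinish g = p (last xs)"
    "path_image g = segs p (path_edges xs)"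
proof -
  have "\<exists>g. arc g \<and> pathstart g = p (hd xs) \<and> pathfinish g = p (last xs) \<and>
    path_image g = segs p (path_edges xs)" using assms
  proof (induction xs rule: path_edges.induct)
    case (1 x y zs)
    have inj: "inj_on p (set (x # y # zs))" using "1.prems"(3) by (simp add: plane_drawing_def)
    then have ne: "p x \<noteq> p y" using "1.prems"(1) by (auto simp: inj_on_def)
    show ?case
    proof (cases "zs = []")
      case True
      then show ?thesis using ne
        by (intro exI[of _ "linepath (p x) (p y)"]) (auto simp: segs_def segment_convex_hull)
    next
      case False
      then have "2 \<le> length (y # zs)" by (cases zs) auto
      then obtain g where g: "arc g" "pathstart g = p y" "pathfinish g = p (last (y # zs))"
        "path_image g = segs p (path_edges (y # zs))"
        using 1 plane_drawing_mono[OF "1.prems"(3), of "set (y # zs)" "path_edges (y # zs)"]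
        by fastforce
      have "convex hull (p ` {x, y}) \<inter> convex hull (p ` e) \<subseteq> {p y}" if e: "e \<in> path_edges (y # zs)" for e
      proof -
        have "x \<notin> e" using path_edges_subset[OF e] "1.prems"(1) by auto
        then show ?thesis using plane_drawingD[OF "1.prems"(3), of "{x, y}" e] e by auto
      qed
      then have "path_image (linepath (p x) (p y)) \<inter> path_image g \<subseteq> {pathstart g}"
        using g by (auto simp: segs_def segment_convex_hull)
      then have "arc (linepath (p x) (p y) +++ g)"
        using g ne by (intro arc_join) auto
      moreover have "path_image (linepath (p x) (p y) +++ g) = segs p (path_edges (x # y # zs))"
        using g by (subst path_image_join) (auto simp: segs_insert segment_convex_hull)
      ultimately show ?thesis using g by (intro exI[of _ "linepath (p x) (p y) +++ g"]) auto
    qed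
  qed auto
  then show ?thesis using that by blast
qed

text \<open>The closing side is joined to the arc formed by the other sides. With at least three
  vertices it differs from all of them, so it meets them only at its ends.\<close>

lemma closed_edges_loop:
  assumes "distinct vs" "3 \<le> length vs" "plane_drawing p (set vs) (closed_edges vs)"
  obtains g where "simple_path g" "pathfinish g = pathstart g" "path_image g = segs p (closed_edges vs)"
proof -
  obtain a w where vs0: "vs = a # w" "2 \<le> length w" using assms(2) by (cases vs) auto
  then obtain B b where w: "w = B @ [b]" by (metis length_0_conv not_numeral_le_zero rev_exhaust)
  have vs: "vs = a # B @ [b]" "B \<noteq> []" using vs0 w by auto
  have d: "distinct (a # B @ [b])" using assms(1) vs by simp
  have ce: "closed_edges vs = insert {a, b} (path_edges (a # B @ [b]))"
    using closed_edges_arc vs by simp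
  have pd: "plane_drawing p (set vs) (insert {a, b} (path_edges (a # B @ [b])))"
    using assms(3) ce by simp
  obtain g where g: "arc g" "pathstart g = p a" "pathfinish g = p b"
    "path_image g = segs p (path_edges (a # B @ [b]))"
    by (rule path_edges_arc[OF d, of p]) (use plane_drawing_mono[OF pd] vs in auto)
  have ne: "p b \<noteq> p a" using pd d vs by (auto simp: plane_drawing_def inj_on_def)
  have "convex hull (p ` {a, b}) \<inter> convex hull (p ` e) \<subseteq> {p a, p b}"
    if e: "e \<in> path_edges (a # B @ [b])" for e
  proof -
    have "e \<noteq> {a, b}" using ends_notin_path_edges[OF d vs(2)] e by auto
    then show ?thesis using plane_drawingD[OF pd, of "{a, b}" e] e by auto
  qed
  then have "path_image g \<inter> path_image (linepath (p b) (p a)) \<subseteq> {pathstart g, pathstart (linepath (p b) (p a))}"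
    using g by (auto simp: segs_def segment_convex_hull insert_commute)
  then have "simple_path (g +++ linepath (p b) (p a))"
    using g ne by (intro simple_path_join_loop) auto
  moreover have "path_image (g +++ linepath (p b) (p a)) = segs p (closed_edges vs)"
    using g by (subst path_image_join) (auto simp: segs_insert segment_convex_hull ce insert_commute)
  ultimately show ?thesis using that g by auto
qed

text \<open>The two boundary paths and the chord, all directed from \<open>a\<close> to
  \<open>b\<close>, form a theta curve: they meet pairwise only in \<open>p a\<close> and
  \<open>p b\<close>. The assumption \<open>meets\<close> says that the chord runs through the
  inside and not around it.\<close>

lemma inside_split:
  assumes d: "distinct (a # B @ b # C)" and BC: "B \<noteq> []" "C \<noteq> []"
    and pd: "plane_drawing p (set (a # B @ b # C)) (insert {a, b} (closed_edges (a # B @ b # C)))"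
    and meets: "convex hull (p ` {a, b}) \<inter> inside (segs p (closed_edges (a # B @ b # C))) \<noteq> {}"
  shows "inside (segs p (closed_edges (a # B @ [b]))) \<inter> inside (segs p (closed_edges (b # C @ [a]))) = {}"
    and "inside (segs p (closed_edges (a # B @ [b]))) \<union> inside (segs p (closed_edges (b # C @ [a]))) \<union>
      (convex hull (p ` {a, b}) - p ` {a, b}) = inside (segs p (closed_edges (a # B @ b # C)))"
proof -
  let ?E1 = "path_edges (a # B @ [b])" and ?E2 = "path_edges (b # C @ [a])"
  have d1: "distinct (a # B @ [b])" and d2: "distinct (b # C @ [a])" using d by auto
  have ce: "closed_edges (a # B @ b # C) = ?E1 \<union> ?E2" by (rule closed_edges_split)
  have pd': "plane_drawing p (set (a # B @ b # C)) (insert {a, b} (?E1 \<union> ?E2))" using pd ce by simp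
  obtain g1 where g1: "arc g1" "pathstart g1 = p a" "pathfinish g1 = p b" "path_image g1 = segs p ?E1"
    by (rule path_edges_arc[OF d1, of p]) (auto intro: plane_drawing_mono[OF pd'])
  obtain g2 where g2: "arc g2" "pathstart g2 = p b" "pathfinish g2 = p a" "path_image g2 = segs p ?E2"
    by (rule path_edges_arc[OF d2, of p]) (auto intro: plane_drawing_mono[OF pd'])
  let ?l = "linepath (p a) (p b)"
  have ne: "p a \<noteq> p b" using pd d by (auto simp: plane_drawing_def inj_on_def)
  have n1: "{a, b} \<notin> ?E1" and n2: "{a, b} \<notin> ?E2"
    using ends_notin_path_edges[OF d1] ends_notin_path_edges[OF d2] BC by (auto simp: insert_commute)
  \<comment> \<open>Edges from different boundary paths share at most \<open>a\<close> and
    \<open>b\<close>. They could coincide only as \<open>{a, b}\<close>, which lies on neither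
    path.\<close>
  have i12: "convex hull (p ` e) \<inter> convex hull (p ` f) \<subseteq> {p a, p b}" if e: "e \<in> ?E1" and f: "f \<in> ?E2" for e f
  proof -
    have sub: "e \<inter> f \<subseteq> {a, b}" using path_edges_subset[OF e] path_edges_subset[OF f] d by auto
    have "e \<noteq> f"
    proof
      assume "e = f"
      then have "e \<subseteq> {a, b}" "card e = 2" using sub path_edges_card[OF d1 e] by auto
      then have "e = {a, b}" using d by (intro card_subset_eq) auto
      then show False using n1 e by simp
    qed
    then show ?thesis using plane_drawingD[OF pd', of e f] e f sub by auto
  qed
  have i: "convex hull (p ` {a, b}) \<inter> convex hull (p ` e) \<subseteq> {p a, p b}" if e: "e \<in> ?E1 \<union> ?E2" for e
  proof -
    have "e \<noteq> {a, b}" using n1 n2 e by auto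
    then show ?thesis using plane_drawingD[OF pd', of "{a, b}" e] e by auto
  qed
  have mem: "p a \<in> path_image g1" "p b \<in> path_image g1" "p a \<in> path_image g2" "p b \<in> path_image g2"
    using g1 g2 pathstart_in_path_image pathfinish_in_path_image by metis+
  have l: "path_image ?l = convex hull (p ` {a, b})" by (simp add: segment_convex_hull)
  have s12: "path_image g1 \<inter> path_image (reversepath g2) = {p a, p b}"
    using i12 mem by (auto simp: g1 g2 segs_def)
  have s1: "path_image g1 \<inter> path_image ?l = {p a, p b}"
    using i mem unfolding l by (auto simp: g1 segs_def hull_inc)
  have s2: "path_image (reversepath g2) \<inter> path_image ?l = {p a, p b}"
    using i mem unfolding l by (auto simp: g2 segs_def hull_inc)
  have m: "path_image ?l \<inter> inside (path_image g1 \<union> path_image (reversepath g2)) \<noteq> {}"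
    using meets unfolding l ce by (simp add: g1 g2 segs_Un)
  have c1: "closed_edges (a # B @ [b]) = insert {a, b} ?E1"
    and c2: "closed_edges (b # C @ [a]) = insert {a, b} ?E2"
    by (auto simp: closed_edges_arc insert_commute)
  have r: "inside (path_image g1 \<union> path_image ?l) \<inter> inside (path_image (reversepath g2) \<union> path_image ?l) = {} \<and>
     inside (path_image g1 \<union> path_image ?l) \<union> inside (path_image (reversepath g2) \<union> path_image ?l) \<union>
     (path_image ?l - {p a, p b}) = inside (path_image g1 \<union> path_image (reversepath g2))"
    by (rule split_inside_simple_closed_curve[of g1 "p a" "p b" "reversepath g2" ?l])
       (use g1 g2 ne s12 s1 s2 m in \<open>auto simp: arc_imp_simple_path simple_path_reversepath\<close>)
  have eqs: "path_image g1 \<union> path_image ?l = segs p (closed_edges (a # B @ [b]))"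
    "path_image (reversepath g2) \<union> path_image ?l = segs p (closed_edges (b # C @ [a]))"
    "path_image g1 \<union> path_image (reversepath g2) = segs p (closed_edges (a # B @ b # C))"
    unfolding l c1 c2 ce by (auto simp: g1 g2 segs_insert segs_Un)
  show "inside (segs p (closed_edges (a # B @ [b]))) \<inter> inside (segs p (closed_edges (b # C @ [a]))) = {}"
    using r eqs by simp
  show "inside (segs p (closed_edges (a # B @ [b]))) \<union> inside (segs p (closed_edges (b # C @ [a]))) \<union>
      (convex hull (p ` {a, b}) - p ` {a, b}) = inside (segs p (closed_edges (a # B @ b # C)))"
    unfolding eqs[symmetric] l[symmetric] using r by simp
qed

section \<open>Triangulated polygons\<close>

text \<open>The form of \<open>maximal_outerplanar\<close> that is stable under cutting: the
  boundary is any cyclic list, and \<open>E\<close> contains the sides as well, so that a chord can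
  turn into a side.\<close>

definition triangulated_polygon :: "('a \<Rightarrow> complex) \<Rightarrow> 'a list \<Rightarrow> 'a set set \<Rightarrow> bool" where
  "triangulated_polygon p vs E \<longleftrightarrow> distinct vs \<and> plane_drawing p (set vs) E \<and> closed_edges vs \<subseteq> E \<and>
     (\<forall>e\<in>E. e \<subseteq> set vs \<and> card e = 2) \<and>
     (\<forall>e\<in>E - closed_edges vs. convex hull (p ` e) - p ` e \<subseteq> inside (segs p (closed_edges vs))) \<and>
     (\<forall>R\<in>components (inside (segs p (closed_edges vs)) - segs p E).
        \<exists>a b c. {{a, b}, {b, c}, {a, c}} \<subseteq> E \<and> R = interior (convex hull {p a, p b, p c}))"

lemma triangulated_polygon_rotate:
  "triangulated_polygon p (xs @ ys) E \<longleftrightarrow> triangulated_polygon p (ys @ xs) E"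
proof -
  have "distinct (xs @ ys) \<longleftrightarrow> distinct (ys @ xs)" "set (xs @ ys) = set (ys @ xs)" by auto
  then show ?thesis unfolding triangulated_polygon_def closed_edges_rotate[of xs ys] by (simp only:)
qed

lemma triangulated_polygon_finite:
  assumes "triangulated_polygon p vs E" shows "finite E" "\<And>e. e \<in> E \<Longrightarrow> finite e"
proof -
  have "E \<subseteq> Pow (set vs)" using assms by (auto simp: triangulated_polygon_def)
  then show "finite E" by (rule finite_subset) simp
  show "finite e" if "e \<in> E" for e
    using assms that by (auto simp: triangulated_polygon_def intro: finite_subset[of e "set vs"])
qed

text \<open>Both families split the same set into disjoint nonempty connected open pieces, and such
  a decomposition is unique.\<close>

lemma components_Un_open:
  fixes U V :: "'a::real_normed_vector set"
  assumes "open U" "open V" "U \<inter> V = {}"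
  shows "components (U \<union> V) = components U \<union> components V"
proof (rule connected_disjoint_Union_open_unique)
  show "pairwise disjnt (components (U \<union> V))"
    by (auto simp: pairwise_def disjnt_def dest: components_nonoverlap)
  have "disjnt C D" if "C \<in> components U" "D \<in> components V" for C D
    using that assms(3) in_components_subset unfolding disjnt_def by blast
  then show "pairwise disjnt (components U \<union> components V)"
    using components_nonoverlap unfolding pairwise_def disjnt_def by (metis Int_commute UnE)
  show "open S \<and> connected S \<and> S \<noteq> {}" if "S \<in> components (U \<union> V)" for S
    using that assms open_components[of "U \<union> V" S] in_components_connected in_components_nonempty by blast
  show "open S \<and> connected S \<and> S \<noteq> {}" if "S \<in> components U \<union> components V" for S
    using that assms open_components in_components_connected in_components_nonempty by blast
qed (simp add: Union_Un_distrib)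

lemma vertex_in_closed_edges:
  assumes "v \<in> set vs" "2 \<le> length vs" obtains e where "e \<in> closed_edges vs" "v \<in> e"
proof -
  obtain xs ys where vs: "vs = xs @ v # ys" using assms(1) by (meson split_list)
  then have ne: "ys @ xs \<noteq> []" using assms(2) by auto
  have "closed_edges vs = path_edges (v # (ys @ xs) @ [v])"
    using closed_edges_rotate[of xs "v # ys"] vs by (simp add: closed_edges_def)
  then show ?thesis using that[of "{v, hd (ys @ xs)}"] ne path_edges_Cons[of "(ys @ xs) @ [v]" v]
    by (cases "ys @ xs") auto
qed

lemma vertex_in_segs:
  assumes "v \<in> set vs" "2 \<le> length vs" shows "p v \<in> segs p (closed_edges vs)"
  using vertex_in_closed_edges[OF assms] unfolding segs_def by (metis UN_I hull_inc imageI)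

text \<open>Edges meet only in common vertices, so no vertex lies in the relative interior of an
  edge.\<close>

lemma vertex_on_edge:
  assumes pd: "plane_drawing p V E" and "e \<in> E" "f \<in> E" "v \<in> e" "e \<subseteq> V" "f \<subseteq> V" "p v \<in> convex hull (p ` f)"
  shows "v \<in> f"
proof (cases "e = f")
  case False
  then have "p v \<in> p ` (e \<inter> f)"
    using plane_drawingD[OF pd, of e f] assms by (auto simp: hull_inc)
  then show ?thesis using assms by (auto simp: plane_drawing_def inj_on_def)
qed (use assms in auto)

lemma open_edge:
  fixes p :: "'a \<Rightarrow> complex"
  assumes "inj_on p e" "card e = 2"
  shows "connected (convex hull (p ` e) - p ` e)" "convex hull (p ` e) - p ` e \<noteq> {}"
    "closure (convex hull (p ` e) - p ` e) = convex hull (p ` e)"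
proof -
  obtain a b where e: "e = {a, b}" "a \<noteq> b" using assms(2) by (meson card_2_iff)
  then have ne: "p a \<noteq> p b" using assms(1) by auto
  have "convex hull (p ` e) - p ` e = open_segment (p a) (p b)" "convex hull (p ` e) = closed_segment (p a) (p b)"
    by (auto simp: e segment_convex_hull open_segment_def)
  then show "connected (convex hull (p ` e) - p ` e)" "convex hull (p ` e) - p ` e \<noteq> {}"
    "closure (convex hull (p ` e) - p ` e) = convex hull (p ` e)"
    using ne closure_open_segment[of "p a" "p b"] convex_connected[OF convex_open_segment(1)[of "p a" "p b"]] by simp_all
qed

lemma compact_closed_segs: "compact (segs p (closed_edges vs))"
  by (intro compact_segs) (auto intro: finite_subset[OF closed_edges_subset])

text \<open>The faces of the whole are those of the two halves, because no edge of one half enters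
  the inside of the other. This serves both to cut a given drawing and to assemble one.\<close>

lemma components_split:
  assumes d: "distinct (a # B @ b # C)" and BC: "B \<noteq> []" "C \<noteq> []"
    and pd: "plane_drawing p (set (a # B @ b # C)) (insert {a, b} (closed_edges (a # B @ b # C)))"
    and meets: "convex hull (p ` {a, b}) \<inter> inside (segs p (closed_edges (a # B @ b # C))) \<noteq> {}"
    and E1: "closed_edges (a # B @ [b]) \<subseteq> E1" "\<And>e. e \<in> E1 \<Longrightarrow> e \<subseteq> set (a # B @ [b])"
      "\<And>e. e \<in> E1 - closed_edges (a # B @ [b]) \<Longrightarrow>
        convex hull (p ` e) - p ` e \<subseteq> inside (segs p (closed_edges (a # B @ [b])))"
    and E2: "closed_edges (b # C @ [a]) \<subseteq> E2" "\<And>e. e \<in> E2 \<Longrightarrow> e \<subseteq> set (b # C @ [a])"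
      "\<And>e. e \<in> E2 - closed_edges (b # C @ [a]) \<Longrightarrow>
        convex hull (p ` e) - p ` e \<subseteq> inside (segs p (closed_edges (b # C @ [a])))"
  shows "components (inside (segs p (closed_edges (a # B @ b # C))) - segs p (E1 \<union> E2)) =
    components (inside (segs p (closed_edges (a # B @ [b]))) - segs p E1) \<union>
    components (inside (segs p (closed_edges (b # C @ [a]))) - segs p E2)"
proof -
  let ?v = "a # B @ b # C" and ?v1 = "a # B @ [b]" and ?v2 = "b # C @ [a]"
  let ?in = "\<lambda>vs. inside (segs p (closed_edges vs))"
  note sp = inside_split[OF d BC pd meets]
  have fin: "finite E" "\<And>e. e \<in> E \<Longrightarrow> finite e" if "\<And>e. e \<in> E \<Longrightarrow> e \<subseteq> set vs" for E and vs :: "'a list"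
  proof -
    show "finite E" using that by (intro finite_subset[of E "Pow (set vs)"]) auto
    show "finite e" if e: "e \<in> E" for e
      using \<open>\<And>e. e \<in> E \<Longrightarrow> e \<subseteq> set vs\<close>[OF e] by (rule finite_subset) simp
  qed
  have c1: "closed_edges ?v1 = insert {a, b} (path_edges ?v1)"
    and c2: "closed_edges ?v2 = insert {a, b} (path_edges ?v2)"
    by (auto simp: closed_edges_arc insert_commute)
  have no: "?in vs \<inter> segs p (closed_edges vs) = {}" for vs by (rule inside_no_overlap)
  have cl1: "segs p (closed_edges ?v1) \<subseteq> segs p (closed_edges ?v) \<union> convex hull (p ` {a, b})"
    and cl2: "segs p (closed_edges ?v2) \<subseteq> segs p (closed_edges ?v) \<union> convex hull (p ` {a, b})"
    unfolding c1 c2 closed_edges_split[of a B b C] segs_Un segs_insert by auto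
  have ab: "convex hull (p ` {a, b}) \<subseteq> segs p (closed_edges ?v1)"
    "convex hull (p ` {a, b}) \<subseteq> segs p (closed_edges ?v2)" unfolding c1 c2 segs_insert by auto
  \<comment> \<open>The boundary of a half lies on the outer polygon and the chord. The inside of
    the other half misses both: it lies inside the outer polygon, and the chord is part of its own
    boundary.\<close>
  have d12: "?in ?v1 \<inter> segs p (closed_edges ?v2) = {}" "?in ?v2 \<inter> segs p (closed_edges ?v1) = {}"
    using no[of ?v] no[of ?v1] no[of ?v2] ab cl1 cl2 sp(2) by blast+
  have o2: "?in ?v1 \<inter> segs p E2 = {}"
  proof -
    \<comment> \<open>An inner edge of the second half has its open segment in the second inside,
      which is disjoint from the first, and its endpoints on the second boundary.\<close>
    have "?in ?v1 \<inter> convex hull (p ` e) = {}" if e: "e \<in> E2" for e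
    proof (cases "e \<in> closed_edges ?v2")
      case True then show ?thesis using d12(1) by (auto simp: segs_def)
    next
      case False
      have "p ` e \<subseteq> segs p (closed_edges ?v2)" using E2(2)[OF e] vertex_in_segs[of _ ?v2 p] by force
      moreover have "convex hull (p ` e) - p ` e \<subseteq> ?in ?v2" using E2(3) False e by blast
      ultimately show ?thesis using d12(1) sp(1) by blast
    qed
    then show ?thesis by (auto simp: segs_def)
  qed
  have o1: "?in ?v2 \<inter> segs p E1 = {}"
  proof -
    have "?in ?v2 \<inter> convex hull (p ` e) = {}" if e: "e \<in> E1" for e
    proof (cases "e \<in> closed_edges ?v1")
      case True then show ?thesis using d12(2) by (auto simp: segs_def)
    next
      case False
      have "p ` e \<subseteq> segs p (closed_edges ?v1)" using E1(2)[OF e] vertex_in_segs[of _ ?v1 p] by force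
      moreover have "convex hull (p ` e) - p ` e \<subseteq> ?in ?v1" using E1(3) False e by blast
      ultimately show ?thesis using d12(2) sp(1) by blast
    qed
    then show ?thesis by (auto simp: segs_def)
  qed
  have abE: "convex hull (p ` {a, b}) \<subseteq> segs p E1"
    using ab segs_mono[OF E1(1), of p] by blast
  \<comment> \<open>The open chord, the third piece of the inside, disappears because the chord is
    among the deleted edges.\<close>
  have "?in ?v - segs p (E1 \<union> E2) = (?in ?v1 - segs p E1) \<union> (?in ?v2 - segs p E2)"
    using o1 o2 abE unfolding sp(2)[symmetric] segs_Un by blast
  moreover have "compact (segs p E1)" "compact (segs p E2)"
    using fin[OF E1(2)] fin[OF E2(2)] by (intro compact_segs; simp)+
  then have "open (?in ?v1 - segs p E1)" "open (?in ?v2 - segs p E2)"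
    by (intro open_Diff open_inside compact_imp_closed compact_closed_segs; simp)+
  ultimately show ?thesis using components_Un_open[of "?in ?v1 - segs p E1" "?in ?v2 - segs p E2"] sp(1)
    by auto
qed

section \<open>Combinatorial triangulations and their extraction from a drawing\<close>

text \<open>Digons are allowed, so that a side of a split may be empty.\<close>

inductive polygon_triangulation :: "'a list \<Rightarrow> 'a set set \<Rightarrow> bool" where
  digon: "a \<noteq> b \<Longrightarrow> polygon_triangulation [a, b] {{a, b}}"
| triangle: "distinct [a, b, c] \<Longrightarrow> polygon_triangulation [a, b, c] {{a, b}, {b, c}, {a, c}}"
| split: "polygon_triangulation (a # B @ [b]) E \<Longrightarrow> polygon_triangulation (b # C @ [a]) F \<Longrightarrow> distinct (a # B @ b # C) \<Longrightarrow>
    polygon_triangulation (a # B @ b # C) (E \<union> F)"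
| rotate: "polygon_triangulation (xs @ ys) E \<Longrightarrow> polygon_triangulation (ys @ xs) E"

text \<open>Settles the chordless case, where the only face is a triangle with boundary edges as
  sides. The neighbours of \<open>a\<close> on the cycle must be \<open>b\<close> and
  \<open>c\<close>; the path through the remaining vertices then has its two ends joined by one of
  its own edges, so it has just two vertices.\<close>

lemma closed_edges_triangle:
  assumes "distinct vs" "{{a, b}, {b, c}, {a, c}} \<subseteq> closed_edges vs" "distinct [a, b, c]"
  shows "length vs = 3"
proof -
  have "a \<in> set vs" using closed_edges_subset[of "{a, b}" vs] assms(2) by auto
  then obtain xs ys where vs: "vs = xs @ a # ys" by (meson split_list)
  define w where "w = ys @ xs"
  have d: "distinct (a # w)" using assms(1) vs by (auto simp: w_def)
  have ce: "closed_edges vs = path_edges (a # w @ [a])"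
    using closed_edges_rotate[of xs "a # ys"] vs by (simp add: closed_edges_def w_def)
  have w: "w \<noteq> []" using ce assms(2,3) by (auto simp: doubleton_eq_iff)
  then have ce: "closed_edges vs = {{a, hd w}, {last w, a}} \<union> path_edges w"
    unfolding ce using path_edges_snoc[of w a] path_edges_Cons[of "w @ [a]" a] by auto
  have na: "a \<notin> e" if "e \<in> path_edges w" for e using path_edges_subset[OF that] d by auto
  have "b \<in> {hd w, last w}" "c \<in> {hd w, last w}" using assms(2) na unfolding ce by (auto simp: doubleton_eq_iff)
  then have bc: "{b, c} = {hd w, last w}" using assms(3) by auto
  moreover have "a \<noteq> b" "a \<noteq> c" using assms(3) by auto
  ultimately have *: "{hd w, last w} \<in> path_edges w" "hd w \<noteq> last w"
    using assms(2,3) unfolding ce by (auto simp: doubleton_eq_iff insert_commute)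
  obtain x w' where w1: "w = x # w'" "w' \<noteq> []" using w *(2) by (cases w; cases "tl w") auto
  obtain B y where w2: "w' = B @ [y]" using w1(2) by (meson rev_exhaust)
  have "B = []" using ends_notin_path_edges[of x B y] * d w1 w2 by auto
  then have "length w = 2" using w1 w2 by simp
  then show ?thesis using vs by (simp add: w_def)
qed

lemma rotate_to_chord:
  assumes "distinct vs" "a \<in> set vs" "b \<in> set vs" "a \<noteq> b"
  obtains xs ys B C where "vs = xs @ ys" "ys @ xs = a # B @ b # C"
proof -
  obtain xs ys where vs: "vs = xs @ a # ys" using assms(2) by (meson split_list)
  then have "b \<in> set (ys @ xs)" using assms by auto
  then obtain B C where "ys @ xs = B @ b # C" by (meson split_list)
  then show ?thesis using that[of xs "a # ys" B C] vs by simp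
qed

text \<open>The strict inclusions hold because \<open>{a, b}\<close>, a chord of the whole, is a
  side of both halves; they drive the induction on the number of chords.\<close>

lemma triangulated_polygon_cases:
  assumes "triangulated_polygon p (a # B @ b # C) E" "{a, b} \<in> E - closed_edges (a # B @ b # C)"
  obtains E1 E2 where "E = E1 \<union> E2" "triangulated_polygon p (a # B @ [b]) E1"
    "triangulated_polygon p (b # C @ [a]) E2"
    "E1 - closed_edges (a # B @ [b]) \<subset> E - closed_edges (a # B @ b # C)"
    "E2 - closed_edges (b # C @ [a]) \<subset> E - closed_edges (a # B @ b # C)"
proof -
  let ?v = "a # B @ b # C" and ?v1 = "a # B @ [b]" and ?v2 = "b # C @ [a]"
  let ?in = "\<lambda>vs. inside (segs p (closed_edges vs))"
  let ?o = "\<lambda>e. convex hull (p ` e) - p ` e"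
  have d: "distinct ?v" and pdE: "plane_drawing p (set ?v) E" and cE: "closed_edges ?v \<subseteq> E"
    and eE: "\<And>e. e \<in> E \<Longrightarrow> e \<subseteq> set ?v \<and> card e = 2"
    and oE: "\<And>e. e \<in> E - closed_edges ?v \<Longrightarrow> ?o e \<subseteq> ?in ?v"
    and tE: "\<And>R. R \<in> components (?in ?v - segs p E) \<Longrightarrow>
        \<exists>a b c. {{a, b}, {b, c}, {a, c}} \<subseteq> E \<and> R = interior (convex hull {p a, p b, p c})"
    using assms(1) unfolding triangulated_polygon_def by auto
  have inj: "inj_on p e" if "e \<in> E" for e
    using pdE eE[OF that] by (auto simp only: plane_drawing_def intro: inj_on_subset)
  have c1: "closed_edges ?v1 = insert {a, b} (path_edges ?v1)"
    and c2: "closed_edges ?v2 = insert {a, b} (path_edges ?v2)"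
    by (auto simp: closed_edges_arc insert_commute)
  have c: "closed_edges ?v = path_edges ?v1 \<union> path_edges ?v2" by (rule closed_edges_split)
  have B: "B \<noteq> []" and C: "C \<noteq> []" using assms(2) unfolding c by (auto simp: insert_commute)
  have pd: "plane_drawing p (set ?v) (insert {a, b} (closed_edges ?v))"
    using plane_drawing_mono[OF pdE] assms(2) cE by auto
  have meets: "convex hull (p ` {a, b}) \<inter> ?in ?v \<noteq> {}"
    using oE[of "{a, b}"] open_edge(2)[OF inj, of "{a, b}"] eE[of "{a, b}"] assms(2) by blast
  note sp = inside_split[OF d B C pd meets]
  have no: "?in vs \<inter> segs p (closed_edges vs) = {}" for vs by (rule inside_no_overlap)
  have opens: "open (?in vs)" for vs
    by (intro open_inside compact_imp_closed compact_closed_segs)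
  have ce1: "closed_edges ?v1 \<subseteq> E" and ce2: "closed_edges ?v2 \<subseteq> E"
    using assms(2) cE unfolding c1 c2 c by auto
  \<comment> \<open>A chord goes to the half whose inside contains its open segment.\<close>
  define G where "G vs = closed_edges vs \<union> {e \<in> E - closed_edges ?v. ?o e \<subseteq> ?in vs}" for vs
  \<comment> \<open>The open segment is connected and avoids the cutting chord, so it cannot meet
    both of the disjoint open insides.\<close>
  have side: "?o e \<subseteq> ?in ?v1 \<or> ?o e \<subseteq> ?in ?v2" if e: "e \<in> E - closed_edges ?v" "e \<noteq> {a, b}" for e
  proof -
    have "?o e \<inter> convex hull (p ` {a, b}) = {}"
      using plane_drawingD[OF pdE, of e "{a, b}"] e assms(2) by auto
    then have "?o e \<subseteq> ?in ?v1 \<union> ?in ?v2" using oE[OF e(1)] unfolding sp(2)[symmetric] by blast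
    then show ?thesis
      using connectedD[OF open_edge(1)[OF inj, of e] opens[of ?v1] opens[of ?v2]] e eE[of e] sp(1) by blast
  qed
  have E: "E = G ?v1 \<union> G ?v2"
  proof (intro equalityI subsetI)
    fix e assume e: "e \<in> E"
    consider "e \<in> closed_edges ?v" | "e = {a, b}" | "e \<in> E - closed_edges ?v" "e \<noteq> {a, b}" using e by blast
    then show "e \<in> G ?v1 \<union> G ?v2"
      by cases (use side[of e] in \<open>auto simp: G_def c c1 c2\<close>)
  qed (use ce1 ce2 in \<open>auto simp: G_def\<close>)
  \<comment> \<open>An endpoint of an inner edge of a half is in the closure of that inside. As a
    vertex of the outer polygon it is not in the inside itself, so it lies on a side of the half and
    is a vertex of that side by \<open>vertex_on_edge\<close>.\<close>
  have part: "e \<subseteq> set vs" if e: "e \<in> G vs" and vs: "closed_edges vs \<subseteq> E" "?in vs \<subseteq> ?in ?v" for e vs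
  proof (cases "e \<in> closed_edges vs")
    case True then show ?thesis by (rule closed_edges_subset)
  next
    case False
    then have e': "e \<in> E - closed_edges ?v" "?o e \<subseteq> ?in vs" using e by (auto simp: G_def)
    show ?thesis
    proof
      fix v assume v: "v \<in> e"
      have "v \<in> set ?v" using eE[of e] e'(1) v by blast
      then have vs_v: "p v \<in> segs p (closed_edges ?v)" by (rule vertex_in_segs) simp
      have "p v \<in> closure (?o e)" using open_edge(3)[OF inj, of e] e' eE[of e] v by (auto simp: hull_inc)
      also have "\<dots> \<subseteq> closure (?in vs)" using e' by (intro closure_mono)
      also have "\<dots> \<subseteq> segs p (closed_edges vs) \<union> ?in vs"
        by (intro closure_inside_subset compact_imp_closed compact_closed_segs)
      finally have "p v \<in> segs p (closed_edges vs)"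
        using no[of ?v] vs(2) vs_v by blast
      then obtain g where g: "g \<in> closed_edges vs" "p v \<in> convex hull (p ` g)" by (auto simp: segs_def)
      have "v \<in> g" using vertex_on_edge[OF pdE, of e g v] e' g v vs eE[of e] eE[of g] by blast
      then show "v \<in> set vs" using closed_edges_subset[OF g(1)] by auto
    qed
  qed
  have in12: "?in ?v1 \<subseteq> ?in ?v" "?in ?v2 \<subseteq> ?in ?v" using sp(2) by blast+
  have comp: "components (?in ?v - segs p E) =
    components (?in ?v1 - segs p (G ?v1)) \<union> components (?in ?v2 - segs p (G ?v2))"
    unfolding E by (rule components_split[OF d B C pd meets])
      (use part[of _ ?v1] part[of _ ?v2] ce1 ce2 in12 in \<open>auto simp: G_def\<close>)
  have tri: "triangulated_polygon p vs (G vs)"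
    if dv: "distinct vs" and vs: "closed_edges vs \<subseteq> E" "?in vs \<subseteq> ?in ?v" "set vs \<subseteq> set ?v"
      and sub: "components (?in vs - segs p (G vs)) \<subseteq> components (?in ?v - segs p E)"
      and other: "\<And>e. e \<in> E - G vs \<Longrightarrow> ?o e \<inter> ?in vs = {}" for vs
    unfolding triangulated_polygon_def
  proof (intro conjI ballI)
    have GE: "G vs \<subseteq> E" using vs by (auto simp: G_def)
    show "plane_drawing p (set vs) (G vs)" using plane_drawing_mono[OF pdE vs(3) GE] .
    show "closed_edges vs \<subseteq> G vs" by (auto simp: G_def)
    show "e \<subseteq> set vs" "card e = 2" if "e \<in> G vs" for e using part[OF that] vs eE GE that by blast+
    show "?o e \<subseteq> ?in vs" if "e \<in> G vs - closed_edges vs" for e using that by (auto simp: G_def)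
    fix R assume R: "R \<in> components (?in vs - segs p (G vs))"
    then obtain x y z where xyz: "{{x, y}, {y, z}, {x, z}} \<subseteq> E" "R = interior (convex hull {p x, p y, p z})"
      using tE[of R] sub by blast
    have "R \<noteq> {}" "R \<subseteq> ?in vs" using in_components_nonempty[OF R] in_components_subset[OF R] by auto
    then have "convex hull {p x, p y, p z} = closure R"
      unfolding xyz by (simp add: convex_closure_interior finite_imp_compact_convex_hull compact_imp_closed)
    also have "\<dots> \<subseteq> closure (?in vs)" using \<open>R \<subseteq> ?in vs\<close> by (rule closure_mono)
    also have "\<dots> \<subseteq> segs p (closed_edges vs) \<union> ?in vs"
      by (intro closure_inside_subset compact_imp_closed compact_closed_segs)
    finally have hull: "convex hull {p x, p y, p z} \<subseteq> segs p (closed_edges vs) \<union> ?in vs" .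
    \<comment> \<open>A side \<open>e\<close> of the triangle that belonged only to the other half
      would have its open segment outside this inside, yet within the closure of the face. It would
      thus run along this boundary and meet a different edge away from common vertices.\<close>
    have "e \<in> G vs" if e: "e \<in> E" "p ` e \<subseteq> {p x, p y, p z}" for e
    proof (rule ccontr)
      assume n: "e \<notin> G vs"
      obtain u where u: "u \<in> ?o e" using open_edge(2)[OF inj] e eE[of e] by blast
      then have "u \<notin> ?in vs" "u \<in> convex hull {p x, p y, p z}"
        using other e n hull_mono[OF e(2), of convex] by blast+
      then obtain g where g: "g \<in> closed_edges vs" "u \<in> convex hull (p ` g)"
        using hull by (auto simp: segs_def)
      then have "e \<noteq> g" using n by (auto simp: G_def)
      then have "convex hull (p ` e) \<inter> convex hull (p ` g) = p ` (e \<inter> g)"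
        using plane_drawingD[OF pdE e(1), of g] g vs(1) by auto
      then show False using g u by auto
    qed
    then show "\<exists>a b c. {{a, b}, {b, c}, {a, c}} \<subseteq> G vs \<and> R = interior (convex hull {p a, p b, p c})"
      using xyz by (intro exI[of _ x] exI[of _ y] exI[of _ z]) auto
  qed fact
  have other: "?o e \<inter> ?in v = {}" if "e \<in> E - G v" "v = ?v1 \<and> v' = ?v2 \<or> v = ?v2 \<and> v' = ?v1" for e v v'
  proof (cases "e \<in> closed_edges ?v")
    case True
    then have "?o e \<subseteq> segs p (closed_edges ?v)" by (auto simp: segs_def)
    then show ?thesis using no[of ?v] in12 that by blast
  next
    case False
    then have "e \<noteq> {a, b}" using that c1 c2 by (auto simp: G_def)
    then show ?thesis using side[of e] that False sp(1) by (auto simp: G_def)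
  qed
  have "triangulated_polygon p ?v1 (G ?v1)" "triangulated_polygon p ?v2 (G ?v2)"
    using d ce1 ce2 in12 comp other by (intro tri; force)+
  moreover have "G ?v1 - closed_edges ?v1 \<subset> E - closed_edges ?v" "G ?v2 - closed_edges ?v2 \<subset> E - closed_edges ?v"
    using assms(2) c1 c2 by (auto simp: G_def)
  ultimately show ?thesis using that[OF E] by blast
qed

text \<open>Induction on the number of chords. Without chords the inside is connected by the Jordan
  curve theorem, hence a single triangular face, and the polygon is a triangle.\<close>

lemma triangulated_polygon_imp_triangulation:
  assumes "triangulated_polygon p vs E" "3 \<le> length vs"
  shows "polygon_triangulation vs E"
  using assms
proof (induction "card (E - closed_edges vs)" arbitrary: vs E rule: less_induct)
  case less
  note t = less.prems(1)[unfolded triangulated_polygon_def]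
  show ?case
  proof (cases "E = closed_edges vs")
    case True
    obtain g where g: "simple_path g" "pathfinish g = pathstart g" "path_image g = segs p (closed_edges vs)"
      using closed_edges_loop[of vs p] t less.prems(2) True by auto
    let ?I = "inside (segs p (closed_edges vs))"
    have "?I - segs p E = ?I" using inside_no_overlap[of "segs p E"] True by blast
    then have "?I \<in> components (?I - segs p E)"
      using Jordan_inside_outside[OF g(1,2)] g(3) components_eq_sing_iff[of ?I] by auto
    then obtain a b c where abc: "{{a, b}, {b, c}, {a, c}} \<subseteq> E" using t by meson
    then have "card {a, b} = 2" "card {b, c} = 2" "card {a, c} = 2" using t by auto
    then have "distinct [a, b, c]" by (auto simp: card_2_iff doubleton_eq_iff)
    then have "length vs = 3" using closed_edges_triangle[of vs a b c] abc True t by auto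
    then obtain x y z where vs: "vs = [x, y, z]" by (auto simp: numeral_3_eq_3 length_Suc_conv)
    then have "E = {{x, y}, {y, z}, {x, z}}" using True by (auto simp: closed_edges_def)
    then show ?thesis using polygon_triangulation.triangle[of x y z] t vs by simp
  next
    case False
    then obtain e where e: "e \<in> E - closed_edges vs" using t by auto
    then obtain a b where ab: "e = {a, b}" "a \<noteq> b" using t by (metis DiffD1 card_2_iff)
    then have "a \<in> set vs" "b \<in> set vs" "distinct vs" using t e by auto
    then obtain xs ys B C where vs: "vs = xs @ ys" "ys @ xs = a # B @ b # C"
      using rotate_to_chord ab(2) by metis
    let ?v = "a # B @ b # C"
    have tp: "triangulated_polygon p ?v E" using less.prems(1) triangulated_polygon_rotate[of p xs ys E] vs by simp
    have ce: "closed_edges vs = closed_edges ?v" using closed_edges_rotate[of xs ys] vs by simp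
    have "{a, b} \<in> E - closed_edges ?v" using e ab ce by simp
    from triangulated_polygon_cases[OF tp this] obtain E1 E2 where E12: "E = E1 \<union> E2"
      "triangulated_polygon p (a # B @ [b]) E1" "triangulated_polygon p (b # C @ [a]) E2"
      "E1 - closed_edges (a # B @ [b]) \<subset> E - closed_edges ?v"
      "E2 - closed_edges (b # C @ [a]) \<subset> E - closed_edges ?v" by metis
    have fin: "finite (E - closed_edges ?v)" using triangulated_polygon_finite(1)[OF tp] by simp
    have "B \<noteq> []" "C \<noteq> []" using \<open>{a, b} \<in> E - closed_edges ?v\<close>
      unfolding closed_edges_split by (auto simp: insert_commute)
    then have l: "3 \<le> length (a # B @ [b])" "3 \<le> length (b # C @ [a])" by (cases B; cases C; simp)+
    have "polygon_triangulation (a # B @ [b]) E1" "polygon_triangulation (b # C @ [a]) E2"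
      using less.hyps E12 l psubset_card_mono[OF fin] ce by auto
    then have "polygon_triangulation ?v E" using E12(1) tp polygon_triangulation.split
      by (metis triangulated_polygon_def)
    then show ?thesis using polygon_triangulation.rotate[of ys xs E] vs by simp
  qed
qed

section \<open>The lower bound\<close>

fun path_sum :: "('a \<Rightarrow> 'a \<Rightarrow> 'b::comm_monoid_add) \<Rightarrow> 'a list \<Rightarrow> 'b" where
  "path_sum h (x # y # zs) = h x y + path_sum h (y # zs)"
| "path_sum h _ = 0"

text \<open>Unlike \<open>closed_edges\<close>, this respects direction and multiplicity: a digon
  contributes \<open>h a b + h b a\<close>, and a chord enters the two halves of a split in opposite
  directions.\<close>

definition closed_sum :: "('a \<Rightarrow> 'a \<Rightarrow> 'b::comm_monoid_add) \<Rightarrow> 'a list \<Rightarrow> 'b" where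
  "closed_sum h vs = path_sum h (vs @ [hd vs])"

lemma path_sum_append: "path_sum h (xs @ y # ys) = path_sum h (xs @ [y]) + path_sum h (y # ys)"
proof (induction h xs rule: path_sum.induct)
  case (1 h x y zs) then show ?case by (simp add: add.assoc)
next
  case "2_1" then show ?case by simp
next
  case ("2_2" h x) then show ?case by (cases ys) auto
qed

lemma closed_sum_rotate: "closed_sum h (xs @ ys) = closed_sum h (ys @ xs)"
proof (cases "xs = [] \<or> ys = []")
  case False
  then obtain x xs' y ys' where [simp]: "xs = x # xs'" "ys = y # ys'"
    by (meson list.exhaust)
  show ?thesis
    using path_sum_append[of h xs y "ys' @ [x]"] path_sum_append[of h ys x "xs' @ [y]"]
    by (auto simp: closed_sum_def add.commute)
qed auto

lemma closed_sum_split: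
  "closed_sum h (a # B @ b # C) = path_sum h (a # B @ [b]) + path_sum h (b # C @ [a])"
  using path_sum_append[of h "a # B" b "C @ [a]"] by (simp add: closed_sum_def)

lemma closed_sum_arc: "closed_sum h (a # B @ [b]) = path_sum h (a # B @ [b]) + h b a"
  using path_sum_append[of h "a # B" b "[a]"] by (auto simp: closed_sum_def)

lemma path_sum_nth: "path_sum h xs = (\<Sum>i<length xs - 1. h (xs ! i) (xs ! Suc i))"
proof (induction h xs rule: path_sum.induct)
  case (1 h x y zs) then show ?case
    by (simp add: sum.lessThan_Suc_shift del: sum.lessThan_Suc)
qed auto

lemma path_edges_nth: "path_edges xs = {{xs ! i, xs ! Suc i} | i. Suc i < length xs}"
proof (induction xs rule: path_edges.induct)
  case (1 x y zs)
  have "{{(x # y # zs) ! i, (x # y # zs) ! Suc i} | i. Suc i < length (x # y # zs)}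
    = (\<lambda>i. {(x # y # zs) ! i, (x # y # zs) ! Suc i}) ` {..<Suc (length zs)}"
    by auto
  also have "\<dots> = insert {x, y} ((\<lambda>i. {(y # zs) ! i, (y # zs) ! Suc i}) ` {..<length zs})"
    unfolding lessThan_Suc_eq_insert_0 by (simp add: image_image)
  also have "(\<lambda>i. {(y # zs) ! i, (y # zs) ! Suc i}) ` {..<length zs} =
    {{(y # zs) ! i, (y # zs) ! Suc i} | i. Suc i < length (y # zs)}" by auto
  finally show ?case using 1 by simp
qed auto

lemma upt_closed_nth: "i < n \<Longrightarrow> ([0..<n] @ [hd [0..<n]]) ! i = i \<and> ([0..<n] @ [hd [0..<n]]) ! Suc i = Suc i mod n"
  by (auto simp: nth_append mod_Suc)

lemma closed_edges_upt: "closed_edges [0..<n] = cycle_edges n"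
proof -
  let ?xs = "[0..<n] @ [hd [0..<n]]"
  have "closed_edges [0..<n] = (\<lambda>i. {?xs ! i, ?xs ! Suc i}) ` {..<n}"
    by (auto simp: closed_edges_def path_edges_nth)
  also have "\<dots> = (\<lambda>i. {i, Suc i mod n}) ` {..<n}"
    by (intro image_cong refl) (simp only: lessThan_iff upt_closed_nth)
  also have "\<dots> = cycle_edges n" by (auto simp: cycle_edges_def)
  finally show ?thesis .
qed

lemma closed_sum_upt: "closed_sum h [0..<n] = (\<Sum>i<n. h i (Suc i mod n))"
proof -
  let ?xs = "[0..<n] @ [hd [0..<n]]"
  have "closed_sum h [0..<n] = (\<Sum>i<n. h (?xs ! i) (?xs ! Suc i))"
    by (simp add: closed_sum_def path_sum_nth)
  also have "\<dots> = (\<Sum>i<n. h i (Suc i mod n))"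
    by (intro sum.cong refl) (simp only: lessThan_iff upt_closed_nth)
  finally show ?thesis .
qed

text \<open>The number of forward steps along the cycle from \<open>u\<close> to \<open>v\<close>;
  adding \<open>n\<close> first keeps the subtraction from truncating.\<close>

definition gap :: "nat \<Rightarrow> nat \<Rightarrow> nat \<Rightarrow> nat" where
  "gap n u v = (v + n - u) mod n"

lemma gap_eq: "u < n \<Longrightarrow> v < n \<Longrightarrow> gap n u v = (if u \<le> v then v - u else v + n - u)"
proof (cases "u \<le> v")
  case True
  assume "v < n"
  have eq: "v + n - u = (v - u) + n" using True by simp
  show ?thesis unfolding gap_def eq mod_add_self2 using True \<open>v < n\<close> by simp
qed (simp add: gap_def)

lemma add_gap: "u < n \<Longrightarrow> v < n \<Longrightarrow> (u + gap n u v) mod n = v"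
  by (auto simp: gap_eq)

lemma gap_swap: "u < n \<Longrightarrow> v < n \<Longrightarrow> u \<noteq> v \<Longrightarrow> gap n v u = n - gap n u v"
  by (auto simp: gap_eq)

lemma gap_pos: "u < n \<Longrightarrow> v < n \<Longrightarrow> u \<noteq> v \<Longrightarrow> 0 < gap n u v \<and> gap n u v < n"
  by (auto simp: gap_eq)

lemma path_sum_gap:
  assumes "set xs \<subseteq> {..<n}" "xs \<noteq> []" shows "(hd xs + path_sum (gap n) xs) mod n = last xs"
  using assms
proof (induction xs rule: path_edges.induct)
  case (1 x y zs)
  have "(x + (gap n x y + path_sum (gap n) (y # zs))) mod n = ((x + gap n x y) mod n + path_sum (gap n) (y # zs)) mod n"
    by (simp add: mod_simps add.assoc)
  also have "\<dots> = last (y # zs)" using 1 by (simp add: add_gap)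
  finally show ?case by simp
qed auto

lemma path_sum_gap_pos:
  assumes "set xs \<subseteq> {..<n}" "distinct xs" "2 \<le> length xs" shows "0 < path_sum (gap n) xs"
proof -
  obtain x y zs where xs: "xs = x # y # zs" using assms(3) by (metis Suc_le_length_iff numeral_2_eq_2)
  then show ?thesis using gap_pos[of x n y] assms by simp
qed

text \<open>The condition \<open>closed_sum (gap n) vs = n\<close> says that the list runs around
  the cycle exactly once. The partial sum from \<open>a\<close> to \<open>b\<close> is then strictly
  between \<open>0\<close> and \<open>n\<close> and congruent to \<open>gap n a b\<close>.\<close>

lemma path_sum_gap_arc:
  assumes "set (a # B @ b # C) \<subseteq> {..<n}" "distinct (a # B @ b # C)" "closed_sum (gap n) (a # B @ b # C) = n"
  shows "path_sum (gap n) (a # B @ [b]) = gap n a b" "path_sum (gap n) (b # C @ [a]) = gap n b a"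
proof -
  let ?s = "path_sum (gap n) (a # B @ [b])" and ?t = "path_sum (gap n) (b # C @ [a])"
  have st: "?s + ?t = n" using assms(3) closed_sum_split[of "gap n" a B b C] by simp
  have "0 < ?s" "0 < ?t" using path_sum_gap_pos[of "a # B @ [b]" n] path_sum_gap_pos[of "b # C @ [a]" n] assms by auto
  then have "?s < n" using st by simp
  have ab: "a < n" "b < n" "a \<noteq> b" using assms by auto
  have "(a + ?s) mod n = b" using path_sum_gap[of "a # B @ [b]" n] assms(1) by simp
  then show s: "?s = gap n a b" using ab \<open>?s < n\<close>
    by (cases "a + ?s < n") (auto simp: gap_eq le_mod_geq)
  show "?t = gap n b a" using st s gap_swap[of a n b] ab by simp
qed

lemma polygon_triangulation_facts:
  assumes "polygon_triangulation vs E"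
  shows "distinct vs" "finite E" "2 \<le> length vs" "\<And>e. e \<in> E \<Longrightarrow> e \<subseteq> set vs \<and> card e = 2" "closed_edges vs \<subseteq> E"
proof -
  have "distinct vs \<and> finite E \<and> 2 \<le> length vs \<and> (\<forall>e\<in>E. e \<subseteq> set vs \<and> card e = 2) \<and> closed_edges vs \<subseteq> E"
    using assms
  proof (induction rule: polygon_triangulation.induct)
    case (split a B b E C F)
    have "closed_edges (a # B @ b # C) \<subseteq> closed_edges (a # B @ [b]) \<union> closed_edges (b # C @ [a])"
      unfolding closed_edges_split closed_edges_arc by auto
    then show ?case using split by auto
  next
    case (rotate xs ys E)
    then show ?case using closed_edges_rotate[of xs ys] by auto
  qed (auto simp: closed_edges_def insert_commute)
  then show "distinct vs" "finite E" "2 \<le> length vs" "\<And>e. e \<in> E \<Longrightarrow> e \<subseteq> set vs \<and> card e = 2" "closed_edges vs \<subseteq> E"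
    by auto
qed

lemma polygon_triangulation_Int:
  assumes "polygon_triangulation (a # B @ [b]) E" "polygon_triangulation (b # C @ [a]) F" "distinct (a # B @ b # C)"
  shows "E \<inter> F = {{a, b}}"
proof -
  have "e = {a, b}" if "e \<in> E" "e \<in> F" for e
  proof -
    have "e \<subseteq> {a, b}" "card e = 2" using polygon_triangulation_facts(4)[OF assms(1) that(1)]
      polygon_triangulation_facts(4)[OF assms(2) that(2)] assms(3) by auto
    then show ?thesis using assms(3) by (intro card_subset_eq) auto
  qed
  moreover have "{a, b} \<in> E" "{a, b} \<in> F"
    using polygon_triangulation_facts(5)[OF assms(1)] polygon_triangulation_facts(5)[OF assms(2)]
    unfolding closed_edges_arc by (auto simp: insert_commute)
  ultimately show ?thesis by blast
qed

text \<open>Let a split have chord length \<open>l\<close>. The two bounds add up with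
  \<open>c\<close> counted twice; the two copies of the chord have corrections of total
  \<open>c + l - 2 * l\<close>, and \<open>l\<close> itself is counted once too often in the sum
  over the edges. What is left is exactly the bound for the whole, with no loss. Only triangles need
  an inequality.\<close>

lemma polygon_triangulation_weight:
  fixes \<phi> :: "nat \<Rightarrow> real" and L :: "nat set \<Rightarrow> real"
  assumes "polygon_triangulation vs E" "set vs \<subseteq> {..<n}" "closed_sum (gap n) vs = n"
    and L: "\<And>u v. u < n \<Longrightarrow> v < n \<Longrightarrow> u \<noteq> v \<Longrightarrow> L {u, v} = real (min (gap n u v) (gap n v u))"
    and digon: "\<And>x y. 0 < x \<Longrightarrow> 0 < y \<Longrightarrow> x + y = n \<Longrightarrow> \<phi> x + \<phi> y = c + real (min x y)"
    and triangle: "\<And>x y z. 0 < x \<Longrightarrow> 0 < y \<Longrightarrow> 0 < z \<Longrightarrow> x + y + z = n \<Longrightarrow> c \<le> \<phi> x + \<phi> y + \<phi> z"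
  shows "c - closed_sum (\<lambda>u v. \<phi> (gap n u v) - L {u, v}) vs \<le> sum L E"
  using assms(1-3)
proof (induction rule: polygon_triangulation.induct)
  case (digon a b)
  then have ab: "a < n" "b < n" "a \<noteq> b" by auto
  have "\<phi> (gap n a b) + \<phi> (gap n b a) = c + real (min (gap n a b) (gap n b a))"
    using gap_pos[of a n b] gap_swap[of a n b] ab by (intro assms(5)) auto
  then show ?case using L[OF ab] by (simp add: closed_sum_def insert_commute)
next
  case (triangle a b x)
  then have *: "a < n" "b < n" "x < n" "a \<noteq> b" "b \<noteq> x" "a \<noteq> x" by auto
  have "c \<le> \<phi> (gap n a b) + \<phi> (gap n b x) + \<phi> (gap n x a)"
    using * triangle.prems(2) gap_pos by (intro assms(6)) (auto simp: closed_sum_def)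
  moreover have "sum L {{a, b}, {b, x}, {a, x}} = L {a, b} + L {b, x} + L {x, a}"
    using * by (subst sum.insert, simp, force simp: doubleton_eq_iff)+ (simp add: insert_commute)
  ultimately show ?case by (simp add: closed_sum_def)
next
  case (split a B b E C F)
  let ?h = "\<lambda>u v. \<phi> (gap n u v) - L {u, v}"
  have ab: "a < n" "b < n" "a \<noteq> b" using split.prems split.hyps by auto
  note arc = path_sum_gap_arc[OF split.prems(1) split.hyps(3) split.prems(2)]
  have "closed_sum (gap n) (a # B @ [b]) = n" "closed_sum (gap n) (b # C @ [a]) = n"
    unfolding closed_sum_arc arc using gap_swap[of a n b] gap_pos[of a n b] ab by auto
  then have "c - closed_sum ?h (a # B @ [b]) \<le> sum L E" "c - closed_sum ?h (b # C @ [a]) \<le> sum L F"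
    using split by auto
  moreover have "sum L (E \<union> F) = sum L E + sum L F - L {a, b}"
    using sum.union_inter[of E F L] polygon_triangulation_facts(2)[OF split.hyps(1)]
      polygon_triangulation_facts(2)[OF split.hyps(2)] polygon_triangulation_Int[OF split.hyps] by simp
  moreover have "\<phi> (gap n a b) + \<phi> (gap n b a) = c + real (min (gap n a b) (gap n b a))"
    using gap_pos[of a n b] gap_swap[of a n b] ab by (intro assms(5)) auto
  moreover have "L {b, a} = L {a, b}" by (simp add: insert_commute)
  ultimately show ?case using L[OF ab] unfolding closed_sum_arc unfolding closed_sum_split by linarith
next
  case (rotate xs ys E)
  then show ?case by (simp add: closed_sum_rotate[of _ xs ys])
qed

text \<open>The least total size of the nodes of a binary tree with \<open>s\<close> leaves, a node being as large as the number of leaves below it.\<close>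

function tree_cost :: "nat \<Rightarrow> real" where
  "tree_cost s = (if s \<le> 1 then 1 else s + Min ((\<lambda>a. tree_cost a + tree_cost (s - a)) ` {1..<s}))"
  by auto
termination by (relation "Wellfounded.measure id") auto

declare tree_cost.simps [simp del]

lemma tree_cost_1: "tree_cost 1 = 1" "tree_cost (Suc 0) = 1"
  by (simp_all add: tree_cost.simps)

lemma tree_cost_rec:
  "2 \<le> s \<Longrightarrow> tree_cost s = s + Min ((\<lambda>a. tree_cost a + tree_cost (s - a)) ` {1..<s})"
  by (subst tree_cost.simps) simp

lemma tree_cost_add:
  assumes "0 < a" "0 < b" shows "tree_cost (a + b) \<le> (a + b) + (tree_cost a + tree_cost b)"
proof -
  have "Min ((\<lambda>x. tree_cost x + tree_cost (a + b - x)) ` {1..<a + b}) \<le> tree_cost a + tree_cost b"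
    by (rule Min_le) (use assms in \<open>auto intro!: image_eqI[of _ _ a]\<close>)
  then show ?thesis using assms by (subst tree_cost_rec) auto
qed

text \<open>Below the root of an optimal tree the line for \<open>q - 1\<close> applies to both
  parts. Their sum plus the root's size \<open>s\<close> is exactly the line for
  \<open>q\<close>.\<close>

lemma tree_cost_ge: "0 < s \<Longrightarrow> (real q + 3) * s - 2 ^ (q + 1) \<le> tree_cost s"
proof (induction s arbitrary: q rule: less_induct)
  case (less s)
  show ?case
  proof (cases "s = 1")
    case True
    have "real q + 1 \<le> 2 ^ q" by (induction q) auto
    then show ?thesis using True by (simp add: tree_cost_1)
  next
    case False
    then have s: "2 \<le> s" using less.prems by simp
    then have "Min ((\<lambda>a. tree_cost a + tree_cost (s - a)) ` {1..<s}) \<in> (\<lambda>a. tree_cost a + tree_cost (s - a)) ` {1..<s}"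
      by (intro Min_in) auto
    then obtain a where a: "a \<in> {1..<s}" "tree_cost s = s + (tree_cost a + tree_cost (s - a))"
      using tree_cost_rec[OF s] by auto
    have r: "real (s - a) = real s - real a" using a by simp
    show ?thesis
    proof (cases q)
      \<comment> \<open>Here the line \<open>3 * a - 2\<close> is used for both parts:
        \<open>4 * s - 4\<close> is at least \<open>3 * s - 2\<close> because
        \<open>s \<ge> 2\<close>.\<close>
      case 0
      then show ?thesis using less.IH[of a 0] less.IH[of "s - a" 0] a s r by simp
    next
      case (Suc q')
      have "(real q' + 3) * a - 2 ^ (q' + 1) \<le> tree_cost a"
        "(real q' + 3) * (real s - real a) - 2 ^ (q' + 1) \<le> tree_cost (s - a)"
        using less.IH[of a q'] less.IH[of "s - a" q'] a r by auto
      then show ?thesis using a(2) Suc by (simp add: algebra_simps)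
    qed
  qed
qed

text \<open>The weight of an arc is the cost of the tree hanging off it; for arcs longer than \<open>n / 2\<close>
  it is chosen so that gluing two polygons along a chord loses nothing.\<close>

definition arc_weight :: "nat \<Rightarrow> real \<Rightarrow> nat \<Rightarrow> real" where
  "arc_weight n c s = (if 2 * s < n then tree_cost s else if 2 * s = n then (c + s) / 2
     else c + (n - s) - tree_cost (n - s))"

text \<open>The weights of long arcs are defined by solving this identity. At the midpoint both arcs
  are equal, which forces the value \<open>(c + s) / 2\<close>.\<close>

lemma arc_weight_add:
  assumes "0 < x" "0 < y" "x + y = n"
  shows "arc_weight n c x + arc_weight n c y = c + real (min x y)"
proof -
  have "n - x = y" "n - y = x" "real y = real n - real x" using assms by auto
  then show ?thesis using assms by (cases "x = y") (auto simp: arc_weight_def min_def)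
qed

text \<open>If \<open>z\<close> exceeds \<open>n / 2\<close>, the claim reduces to
  \<open>tree_cost_add\<close>: the arcs \<open>x\<close> and \<open>y\<close> hang off a common
  root of size \<open>x + y\<close>. The delicate case is \<open>2 * z = n\<close>.\<close>

lemma arc_weight_triangle_aux:
  fixes k n :: nat
  defines "c \<equiv> real n * (real k + 3) - 3 * 2 ^ (k + 1)"
  assumes "0 < x" "0 < y" "x + y + z = n" "n \<le> 2 * z"
  shows "c \<le> arc_weight n c x + arc_weight n c y + arc_weight n c z"
proof (cases "2 * z = n")
  case True
  have xy: "x + y = z" using assms True by simp
  have w: "arc_weight n c x = tree_cost x" "arc_weight n c y = tree_cost y" "arc_weight n c z = (c + z) / 2"
    using assms True by (auto simp: arc_weight_def)
  have r: "real n = 2 * real z" "real z = real x + real y" using xy True by auto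
  have "(c - z) / 2 \<le> tree_cost x + tree_cost y"
  \<comment> \<open>The line for \<open>k\<close> suffices when \<open>z \<ge> 2 * 2 ^ k\<close>,
    the line for \<open>k - 1\<close> when \<open>z \<le> 2 * 2 ^ k\<close>. For
    \<open>k = 0\<close> the first always applies, since \<open>z = x + y \<ge> 2\<close>.\<close>
  proof (cases "z \<le> 2 * 2 ^ k \<and> k \<noteq> 0")
    case t: True
    then obtain k' where k: "k = Suc k'" by (cases k) auto
    have "real z \<le> 4 * 2 ^ k'" using t k by (metis (mono_tags) mult_2 numeral_Bit0 of_nat_le_iff of_nat_mult of_nat_numeral of_nat_power mult.assoc power_Suc)
    moreover have "(real k' + 3) * x - 2 * 2 ^ k' \<le> tree_cost x" "(real k' + 3) * y - 2 * 2 ^ k' \<le> tree_cost y"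
      using tree_cost_ge[of x k'] tree_cost_ge[of y k'] assms by auto
    then have "(real k' + 3) * z - 4 * 2 ^ k' \<le> tree_cost x + tree_cost y"
      by (simp add: r(2) algebra_simps)
    ultimately show ?thesis by (simp add: c_def r(1) k algebra_simps)
  next
    case False
    have "2 * 2 ^ k \<le> z" using False assms xy by (cases "k = 0") auto
    then have "2 * 2 ^ k \<le> real z" using of_nat_mono[of "2 * 2 ^ k" z, where 'a = real] by simp
    moreover have "(real k + 3) * x - 2 * 2 ^ k \<le> tree_cost x" "(real k + 3) * y - 2 * 2 ^ k \<le> tree_cost y"
      using tree_cost_ge[of x k] tree_cost_ge[of y k] assms by auto
    then have "(real k + 3) * z - 4 * 2 ^ k \<le> tree_cost x + tree_cost y"
      by (simp add: r(2) algebra_simps)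
    ultimately show ?thesis by (simp add: c_def r(1) algebra_simps)
  qed
  then show ?thesis unfolding w by (simp add: field_simps)
next
  case False
  have "n - z = x + y" "real n - real z = real (x + y)" using assms by auto
  then show ?thesis using assms False tree_cost_add[of x y] by (auto simp: arc_weight_def)
qed

text \<open>When all three arcs are shorter than \<open>n / 2\<close>, \<open>c\<close> is precisely
  the sum of the three lines for \<open>k\<close>. This is where the constant comes from.\<close>

lemma arc_weight_triangle:
  fixes k n :: nat
  defines "c \<equiv> real n * (real k + 3) - 3 * 2 ^ (k + 1)"
  assumes "0 < x" "0 < y" "0 < z" "x + y + z = n"
  shows "c \<le> arc_weight n c x + arc_weight n c y + arc_weight n c z"
proof -
  consider "n \<le> 2 * x" | "n \<le> 2 * y" | "n \<le> 2 * z" | "2 * x < n" "2 * y < n" "2 * z < n" by linarith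
  then show ?thesis
  proof cases
    case 1 then show ?thesis using arc_weight_triangle_aux[of y z x n k] assms by simp
  next
    case 2 then show ?thesis using arc_weight_triangle_aux[of x z y n k] assms by simp
  next
    case 3 then show ?thesis using arc_weight_triangle_aux[of x y z n k] assms by simp
  next
    case 4
    have "real n = real x + real y + real z" using assms by auto
    then have "c = ((real k + 3) * x - 2 * 2 ^ k) + ((real k + 3) * y - 2 * 2 ^ k) + ((real k + 3) * z - 2 * 2 ^ k)"
      unfolding c_def by (simp add: algebra_simps)
    then show ?thesis
      using tree_cost_ge[of x k] tree_cost_ge[of y k] tree_cost_ge[of z k] 4 assms by (simp add: arc_weight_def)
  qed
qed

section \<open>Chord length as the length of the shorter arc\<close>

lemma min_gap:
  assumes "u < n" "v < n" "u \<le> v"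
  shows "min (gap n u v) (gap n v u) = min (v - u) (n - (v - u))"
    "min (gap n v u) (gap n u v) = min (v - u) (n - (v - u))"
  using assms by (cases "u = v"; simp add: gap_eq min.commute)+

text \<open>The distance to \<open>z\<close> on the cycle changes by at most one along an edge; the
  edge from \<open>n - 1\<close> back to \<open>0\<close> needs its own case.\<close>

lemma gap_step:
  assumes "i < n" "z < n"
  shows "min (gap n i z) (gap n z i) \<le> min (gap n (Suc i mod n) z) (gap n z (Suc i mod n)) + 1"
    and "min (gap n (Suc i mod n) z) (gap n z (Suc i mod n)) \<le> min (gap n i z) (gap n z i) + 1"
proof -
  consider "Suc i mod n = Suc i" "Suc i < n" | "Suc i mod n = 0" "i = n - 1" using assms by (force simp: mod_Suc)
  then have "min (gap n i z) (gap n z i) \<le> min (gap n (Suc i mod n) z) (gap n z (Suc i mod n)) + 1 \<and>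
    min (gap n (Suc i mod n) z) (gap n z (Suc i mod n)) \<le> min (gap n i z) (gap n z i) + 1"
  proof cases
    case 1
    then show ?thesis
    proof (cases "z \<le> i")
      case True
      then have "z \<le> Suc i" by simp
      show ?thesis
        unfolding 1(1) min_gap[OF assms(2,1) True] min_gap[OF assms(2) 1(2) \<open>z \<le> Suc i\<close>]
        using assms 1(2) True by linarith
    next
      case False
      then have "i \<le> z" "Suc i \<le> z" by auto
      then show ?thesis
        unfolding 1(1) min_gap[OF assms \<open>i \<le> z\<close>] min_gap[OF 1(2) assms(2) \<open>Suc i \<le> z\<close>]
        using assms 1(2) by linarith
    qed
  next
    case 2
    have "z \<le> i" "0 < n" using 2 assms by auto
    then show ?thesis
      unfolding 2(1) min_gap[OF assms(2,1) \<open>z \<le> i\<close>] min_gap[OF \<open>0 < n\<close> assms(2) le0]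
      using assms 2(2) by linarith
  qed
  then show "min (gap n i z) (gap n z i) \<le> min (gap n (Suc i mod n) z) (gap n z (Suc i mod n)) + 1"
    "min (gap n (Suc i mod n) z) (gap n z (Suc i mod n)) \<le> min (gap n i z) (gap n z i) + 1" by auto
qed

text \<open>The distance to the fixed last vertex is zero at the end of the path and grows by at
  most one with each edge prepended.\<close>

lemma cycle_path_gap:
  assumes "cycle_path n xs"
  shows "min (gap n (hd xs) (last xs)) (gap n (last xs) (hd xs)) \<le> length xs - 1"
  using assms
proof (induction xs)
  case Nil then show ?case by (simp add: cycle_path_def)
next
  case (Cons x xs)
  show ?case
  proof (cases xs)
    case Nil then show ?thesis using Cons.prems by (simp add: cycle_path_def gap_def)
  next
    case (Cons y ys)
    have p: "set (x # xs) \<subseteq> {..<n}" "distinct (x # xs)"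
      "\<And>m. Suc m < length (x # xs) \<Longrightarrow> {(x # xs) ! m, (x # xs) ! Suc m} \<in> cycle_edges n"
      using Cons.prems by (auto simp: cycle_path_def)
    have "cycle_path n xs" using p(1,2) p(3)[of "Suc _"] Cons by (auto simp: cycle_path_def)
    then have IH: "min (gap n y (last xs)) (gap n (last xs) y) \<le> length xs - 1" using Cons.IH Cons by simp
    obtain i where i: "i < n" "{x, y} = {i, Suc i mod n}" using p(3)[of 0] Cons by (auto simp: cycle_edges_def)
    have "x < n" "y < n" "last xs < n" using p(1) Cons last_in_set[of xs] by auto
    then have "min (gap n x (last xs)) (gap n (last xs) x) \<le> min (gap n y (last xs)) (gap n (last xs) y) + 1"
      using i(2) gap_step[OF i(1)] by (auto simp: doubleton_eq_iff)
    then show ?thesis using IH Cons by simp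
  qed
qed

lemma cycle_path_arc:
  assumes "u < n" "v < n"
  obtains xs where "cycle_path n xs" "hd xs = u" "last xs = v" "length xs = Suc (gap n u v)"
proof -
  let ?xs = "map (\<lambda>m. (u + m) mod n) [0..<Suc (gap n u v)]"
  have g: "gap n u v < n" using assms by (simp add: gap_def)
  \<comment> \<open>The walk makes fewer than \<open>n\<close> steps, so it wraps around at most
    once and cannot return to a visited vertex.\<close>
  have "inj_on (\<lambda>m. (u + m) mod n) {0..<Suc (gap n u v)}"
  proof (rule inj_onI)
    fix x y assume "x \<in> {0..<Suc (gap n u v)}" "y \<in> {0..<Suc (gap n u v)}" "(u + x) mod n = (u + y) mod n"
    then show "x = y" using g assms
      by (cases "u + x < n"; cases "u + y < n") (auto simp: le_mod_geq)
  qed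
  moreover have "{?xs ! m, ?xs ! Suc m} \<in> cycle_edges n" if "Suc m < length ?xs" for m
  proof -
    have "?xs ! m = (u + m) mod n" "?xs ! Suc m = Suc ((u + m) mod n) mod n"
      using that by (auto simp del: upt_Suc simp: mod_simps)
    then show ?thesis using assms by (auto simp: cycle_edges_def)
  qed
  ultimately have "cycle_path n ?xs"
    unfolding cycle_path_def using assms by (auto simp: distinct_map simp del: upt_Suc)
  moreover have "hd ?xs = u" "last ?xs = v" "length ?xs = Suc (gap n u v)"
    using assms add_gap[of u n v] by (auto simp: hd_map last_map simp del: upt_Suc)
  ultimately show ?thesis using that by blast
qed

lemma chord_length_eq:
  assumes "u < n" "v < n" shows "chord_length n {u, v} = min (gap n u v) (gap n v u)"
proof -
  let ?P = "\<lambda>l. \<exists>xs. cycle_path n xs \<and> {hd xs, last xs} = {u, v} \<and> length xs = Suc l"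
  obtain xs where xs: "cycle_path n xs" "hd xs = u" "last xs = v" "length xs = Suc (gap n u v)"
    by (rule cycle_path_arc[OF assms])
  obtain ys where ys: "cycle_path n ys" "hd ys = v" "last ys = u" "length ys = Suc (gap n v u)"
    by (rule cycle_path_arc[OF assms(2,1)])
  have P: "?P (gap n u v)" "?P (gap n v u)"
    by (intro exI[of _ xs], simp add: xs) (intro exI[of _ ys], simp add: ys insert_commute)
  have "min (gap n u v) (gap n v u) \<le> l" if l: "?P l" for l
  proof -
    obtain zs where zs: "cycle_path n zs" "{hd zs, last zs} = {u, v}" "length zs = Suc l" using l by blast
    then consider "hd zs = u" "last zs = v" | "hd zs = v" "last zs = u" by (auto simp: doubleton_eq_iff)
    then show ?thesis by cases (use cycle_path_gap[OF zs(1)] zs(3) in \<open>simp_all add: min.commute\<close>)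
  qed
  then show ?thesis unfolding chord_length_def using P
    by (intro Least_equality) (auto simp: min_def)
qed

lemma chord_length_cycle_edge:
  assumes "2 \<le> n" "e \<in> cycle_edges n" shows "chord_length n e = 1"
proof -
  obtain i where "i < n" "e = {i, Suc i mod n}" using assms(2) by (auto simp: cycle_edges_def)
  then show ?thesis using assms(1) by (auto simp: chord_length_eq gap_eq mod_Suc)
qed

lemma card_cycle_edges:
  assumes "3 \<le> n" shows "card (cycle_edges n) = n"
proof -
  have "cycle_edges n = (\<lambda>i. {i, Suc i mod n}) ` {..<n}" by (auto simp: cycle_edges_def)
  moreover have "inj_on (\<lambda>i. {i, Suc i mod n}) {..<n}"
    using assms by (auto simp: inj_on_def doubleton_eq_iff mod_Suc split: if_splits)
  ultimately show ?thesis by (simp add: card_image)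
qed

text \<open>Every side of the full polygon is an arc of one step. Since \<open>n \<ge> 3\<close>,
  its weight is \<open>tree_cost 1 = 1\<close>, which equals its length, so all corrections
  vanish.\<close>

lemma polygon_triangulation_sum_ge:
  assumes "3 \<le> n" "polygon_triangulation [0..<n] E"
  shows "real n * (real k + 3) - 3 * 2 ^ (k + 1) \<le> (\<Sum>e\<in>E. real (chord_length n e))"
proof -
  let ?c = "real n * (real k + 3) - 3 * 2 ^ (k + 1)" and ?L = "\<lambda>e. real (chord_length n e)"
  have g: "gap n i (Suc i mod n) = 1" "?L {i, Suc i mod n} = 1" if "i < n" for i
  proof -
    show "gap n i (Suc i mod n) = 1" using that assms(1) by (auto simp: gap_eq mod_Suc)
    have "{i, Suc i mod n} \<in> cycle_edges n" unfolding cycle_edges_def using that by blast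
    then show "?L {i, Suc i mod n} = 1" using chord_length_cycle_edge[of n] assms(1) by simp
  qed
  have "?c - closed_sum (\<lambda>u v. arc_weight n ?c (gap n u v) - ?L {u, v}) [0..<n] \<le> sum ?L E"
    by (rule polygon_triangulation_weight[OF assms(2)])
      (use g arc_weight_add arc_weight_triangle in \<open>auto simp: closed_sum_upt chord_length_eq\<close>)
  moreover have "closed_sum (\<lambda>u v. arc_weight n ?c (gap n u v) - ?L {u, v}) [0..<n] = 0"
    unfolding closed_sum_upt using assms(1) by (intro sum.neutral) (auto simp: g arc_weight_def tree_cost_1)
  ultimately show ?thesis by simp
qed

text \<open>The cycle edges contribute \<open>n\<close>; this turns the factor \<open>k + 3\<close>
  of the bounds into the \<open>k + 2\<close> of the theorem.\<close>

lemma sum_chord_length_eq_TCL: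
  assumes "3 \<le> n" "finite E" "cycle_edges n \<subseteq> E"
  shows "(\<Sum>e\<in>E. chord_length n e) = TCL n (E - cycle_edges n) + n"
proof -
  have "(\<Sum>e\<in>E. chord_length n e) = (\<Sum>e\<in>E - cycle_edges n. chord_length n e) + (\<Sum>e\<in>cycle_edges n. chord_length n e)"
    using sum.subset_diff[OF assms(3,2)] .
  also have "(\<Sum>e\<in>cycle_edges n. chord_length n e) = n"
    using chord_length_cycle_edge[of n] card_cycle_edges[of n] assms(1) by simp
  finally show ?thesis by (simp add: TCL_def)
qed

text \<open>Deleting the sides along with the chords changes nothing, because the inside is disjoint
  from its boundary curve.\<close>

lemma maximal_outerplanar_iff:
  "maximal_outerplanar n p D \<longleftrightarrow> 3 \<le> n \<and> D \<inter> cycle_edges n = {} \<and> triangulated_polygon p [0..<n] (cycle_edges n \<union> D)"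
proof (cases "3 \<le> n")
  case n: True
  let ?I = "inside (segs p (cycle_edges n))" and ?E = "cycle_edges n \<union> D"
  have r: "cycle_region n p = ?I" by (simp add: cycle_region_def segs_def edge_segment_def)
  have "segs p ?E = segs p (cycle_edges n) \<union> (\<Union>e\<in>D. edge_segment p e)"
    by (auto simp: segs_def edge_segment_def)
  then have d: "?I - (\<Union>e\<in>D. edge_segment p e) = ?I - segs p ?E"
    using inside_no_overlap[of "segs p (cycle_edges n)"] by blast
  have ce: "e \<subseteq> {..<n} \<and> card e = 2" if "e \<in> cycle_edges n" for e
    using that closed_edges_card[of "[0..<n]" e] closed_edges_subset[of e "[0..<n]"] n
    by (auto simp: closed_edges_upt)
  have u: "set [0..<n] = {..<n}" by auto
  have s: "straight_line_drawing n p ?E \<longleftrightarrow> plane_drawing p {..<n} ?E"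
    by (simp add: straight_line_drawing_def plane_drawing_def edge_segment_def)
  have dd: "?E - cycle_edges n = D" if "D \<inter> cycle_edges n = {}" using that by auto
  show ?thesis
    unfolding maximal_outerplanar_def triangulated_polygon_def closed_edges_upt r d s u
    using n ce dd by (auto simp: edge_segment_def)
qed (simp add: maximal_outerplanar_def)

lemma maximal_outerplanar_TCL_ge:
  assumes "maximal_outerplanar n p D"
  shows "int n * (int k + 2) - 3 * 2 ^ (k + 1) \<le> int (TCL n D)"
proof -
  let ?E = "cycle_edges n \<union> D"
  have n: "3 \<le> n" and D: "D \<inter> cycle_edges n = {}" and t: "triangulated_polygon p [0..<n] ?E"
    using assms by (auto simp: maximal_outerplanar_iff)
  have "polygon_triangulation [0..<n] ?E" using triangulated_polygon_imp_triangulation[OF t] n by simp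
  then have "real n * (real k + 3) - 3 * 2 ^ (k + 1) \<le> (\<Sum>e\<in>?E. real (chord_length n e))"
    using polygon_triangulation_sum_ge n by simp
  also have "\<dots> = real (\<Sum>e\<in>?E. chord_length n e)" by simp
  also have "(\<Sum>e\<in>?E. chord_length n e) = TCL n D + n"
    using sum_chord_length_eq_TCL[of n ?E] n triangulated_polygon_finite(1)[OF t] D
    by (simp add: Un_Diff Diff_triv)
  finally have "real_of_int (int n * (int k + 2) - 3 * 2 ^ (k + 1)) \<le> real_of_int (int (TCL n D))"
    by (simp add: algebra_simps)
  then show ?thesis by (simp only: of_int_le_iff)
qed

section \<open>Triangulations with vertices on a parabola\<close>

text \<open>No three points of a parabola are collinear, and the orientation of three of them is the
  sign of a Vandermonde product, so questions of position become signs of integer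
  differences.\<close>

definition parabola_point :: "nat \<Rightarrow> complex" where
  "parabola_point i = Complex (real i) ((real i)\<^sup>2)"

text \<open>The cross product of the vector from point \<open>u\<close> to point \<open>v\<close>
  with the vector from point \<open>u\<close> to \<open>z\<close>.\<close>

definition left_of :: "nat \<Rightarrow> nat \<Rightarrow> complex \<Rightarrow> real" where
  "left_of u v z = (real v - real u) * (Im z - (real u)\<^sup>2) - ((real v)\<^sup>2 - (real u)\<^sup>2) * (Re z - real u)"

definition ccw :: "nat \<Rightarrow> nat \<Rightarrow> nat \<Rightarrow> bool" where
  "ccw u v w \<longleftrightarrow> 0 < (real v - real u) * (real w - real u) * (real w - real v)"

lemma inj_parabola_point: "inj_on parabola_point A"
  by (auto simp: inj_on_def parabola_point_def)

lemma left_of_parabola_point: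
  "left_of u v (parabola_point w) = (real v - real u) * (real w - real u) * (real w - real v)"
  by (simp add: left_of_def parabola_point_def power2_eq_square algebra_simps)

lemma left_of_pos_iff: "0 < left_of u v (parabola_point w) \<longleftrightarrow> ccw u v w"
  by (simp add: left_of_parabola_point ccw_def)

lemma left_of_ends [simp]: "left_of u v (parabola_point u) = 0" "left_of u v (parabola_point v) = 0"
  by (simp_all add: left_of_parabola_point)

lemma left_of_swap: "left_of v u z = - left_of u v z"
  by (simp add: left_of_def power2_eq_square algebra_simps)

text \<open>The direction from point \<open>u\<close> to point \<open>v\<close>, turned left by a
  right angle; it makes \<open>left_of\<close> an affine functional to which halfspace lemmas
  apply.\<close>

definition left_normal :: "nat \<Rightarrow> nat \<Rightarrow> complex" where
  "left_normal u v = Complex (- ((real v)\<^sup>2 - (real u)\<^sup>2)) (real v - real u)"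

lemma left_of_inner: "left_of u v z = left_normal u v \<bullet> z - left_normal u v \<bullet> parabola_point u"
  by (simp add: left_of_def left_normal_def inner_complex_def parabola_point_def algebra_simps)

lemma ccw_rotate: "ccw u v w \<Longrightarrow> ccw v w u"
proof -
  have "(real w - real v) * (real u - real v) * (real u - real w) = (real v - real u) * (real w - real u) * (real w - real v)"
    by (simp add: algebra_simps)
  then show "ccw u v w \<Longrightarrow> ccw v w u" by (simp only: ccw_def)
qed

lemma ccw_less: "u < v \<Longrightarrow> v < w \<Longrightarrow> ccw u v w"
  by (simp add: ccw_def)

text \<open>A supporting hyperplane cuts out a face, and a face of the hull of a finite set is the
  hull of some of the points.\<close>

lemma convex_hull_Int_hyperplane:
  fixes S :: "'a::euclidean_space set"
  assumes "finite S" "\<And>w. w \<in> S \<Longrightarrow> b \<le> a \<bullet> w" "x \<in> convex hull S" "a \<bullet> x = b"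
  shows "x \<in> convex hull {w \<in> S. a \<bullet> w = b}"
proof -
  have "convex hull S \<subseteq> {x. b \<le> a \<bullet> x}"
    using assms(2) by (intro hull_minimal) (auto simp: convex_halfspace_ge)
  then have "convex hull S \<inter> {x. a \<bullet> x = b} face_of convex hull S"
    by (intro face_of_Int_supporting_hyperplane_ge) auto
  then obtain S' where S': "S' \<subseteq> S" "convex hull S \<inter> {x. a \<bullet> x = b} = convex hull S'"
    using face_of_convex_hull_subset[of S] finite_imp_compact[OF assms(1)] by metis
  then have "S' \<subseteq> {w \<in> S. a \<bullet> w = b}" using hull_subset[of S' convex] by auto
  then show ?thesis using hull_mono[of S' _ convex] S'(2) assms(3,4) by blast
qed

lemma hull_left_of:
  assumes "\<And>w. w \<in> f - {u, v} \<Longrightarrow> ccw u v w" "x \<in> convex hull (parabola_point ` f)"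
  shows "0 \<le> left_of u v x"
proof -
  let ?n = "left_normal u v"
  have "parabola_point ` f \<subseteq> {x. ?n \<bullet> parabola_point u \<le> ?n \<bullet> x}"
  proof (rule image_subsetI)
    fix w assume "w \<in> f"
    then have "0 \<le> left_of u v (parabola_point w)"
      using assms(1)[of w] left_of_pos_iff[of u v w] by (cases "w \<in> {u, v}") auto
    then show "parabola_point w \<in> {x. ?n \<bullet> parabola_point u \<le> ?n \<bullet> x}" unfolding left_of_inner by simp
  qed
  then have "convex hull (parabola_point ` f) \<subseteq> {x. ?n \<bullet> parabola_point u \<le> ?n \<bullet> x}"
    by (rule hull_minimal) (rule convex_halfspace_ge)
  then show ?thesis using assms(2) unfolding left_of_inner by auto
qed

text \<open>The line through points \<open>u\<close> and \<open>v\<close> supports the hull of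
  \<open>f\<close>, and no other point of \<open>f\<close> lies on it.\<close>

lemma hull_left_of_0:
  assumes "\<And>w. w \<in> f - {u, v} \<Longrightarrow> ccw u v w" "finite f" "x \<in> convex hull (parabola_point ` f)" "left_of u v x = 0"
  shows "x \<in> convex hull (parabola_point ` (f \<inter> {u, v}))"
proof -
  let ?n = "left_normal u v"
  have "x \<in> convex hull {z \<in> parabola_point ` f. ?n \<bullet> z = ?n \<bullet> parabola_point u}"
  proof (rule convex_hull_Int_hyperplane)
    fix z assume "z \<in> parabola_point ` f"
    then have "0 \<le> left_of u v z" using hull_left_of[of f u v z] assms(1) by (auto simp: hull_inc)
    then show "?n \<bullet> parabola_point u \<le> ?n \<bullet> z" unfolding left_of_inner by simp
  qed (use assms in \<open>auto simp: left_of_inner\<close>)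
  also have "\<dots> \<subseteq> convex hull (parabola_point ` (f \<inter> {u, v}))"
  proof (rule hull_mono, clarify)
    fix w assume w: "w \<in> f" "?n \<bullet> parabola_point w = ?n \<bullet> parabola_point u"
    then have "left_of u v (parabola_point w) = 0" unfolding left_of_inner by simp
    then have "w \<in> {u, v}" using assms(1)[of w] left_of_pos_iff[of u v w] w(1) by auto
    then show "parabola_point w \<in> parabola_point ` (f \<inter> {u, v})" using w(1) by auto
  qed
  finally show ?thesis .
qed

text \<open>Stated with subsequences so that both sides of a split inherit it.\<close>

definition convex_position :: "nat list \<Rightarrow> bool" where
  "convex_position vs \<longleftrightarrow> (\<forall>x y z. subseq [x, y, z] vs \<longrightarrow> ccw x y z)"

lemma convex_position_subseq: "convex_position ys \<Longrightarrow> subseq xs ys \<Longrightarrow> convex_position xs"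
  unfolding convex_position_def using subseq_order.order_trans by blast

text \<open>A triple from the rotated list consists of a part from \<open>ys\<close> followed by a
  part from \<open>xs\<close>. Exchanging the parts rotates the triple cyclically, which preserves
  \<open>ccw\<close>.\<close>

lemma convex_position_rotate:
  assumes "convex_position (xs @ ys)" shows "convex_position (ys @ xs)"
  unfolding convex_position_def
proof (intro allI impI)
  fix x y z assume "subseq [x, y, z] (ys @ xs)"
  then obtain us ws where *: "[x, y, z] = us @ ws" "subseq us ys" "subseq ws xs"
    by (rule subseq_appendE)
  have "subseq (ws @ us) (xs @ ys)" using * by (intro list_emb_append_mono)
  then have c: "ws @ us = [p, q, r] \<Longrightarrow> ccw p q r" for p q r using assms unfolding convex_position_def by metis
  consider "us = []" "ws = [x, y, z]" | "us = [x]" "ws = [y, z]" | "us = [x, y]" "ws = [z]" | "us = [x, y, z]" "ws = []"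
    using *(1)[symmetric] by (auto simp: append_eq_Cons_conv)
  then show "ccw x y z"
  proof cases
    case 1 then show ?thesis using c[of x y z] by simp
  next
    case 2 then show ?thesis using ccw_rotate[OF ccw_rotate[OF c[of y z x]]] by simp
  next
    case 3 then show ?thesis using ccw_rotate[OF c[of z x y]] by simp
  next
    case 4 then show ?thesis using c[of x y z] by simp
  qed
qed

lemma convex_position_split:
  assumes "convex_position (a # B @ b # C)"
  shows "convex_position (a # B @ [b])" "convex_position (b # C @ [a])"
    "\<And>w. w \<in> set B \<Longrightarrow> ccw b a w" "\<And>w. w \<in> set C \<Longrightarrow> ccw a b w"
proof -
  have "subseq (a # B @ [b]) (a # B @ b # C)"
    using list_emb_append_mono[of "(=)" "a # B" "a # B" "[b]" "b # C"] by simp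
  then show "convex_position (a # B @ [b])" using assms convex_position_subseq by blast
  have "subseq (a # b # C) (a # B @ b # C)" by (simp add: subseq_drop_many)
  then have s: "convex_position (a # b # C)" using assms convex_position_subseq by blast
  then show "convex_position (b # C @ [a])" using convex_position_rotate[of "[a]" "b # C"] by simp
  show "ccw a b w" if "w \<in> set C" for w
    using s that unfolding convex_position_def by (simp add: subseq_singleton_left)
  show "ccw b a w" if "w \<in> set B" for w
  proof -
    have "subseq [w, b] (B @ b # C)" using that list_emb_append_mono[of "(=)" "[w]" B "[b]" "b # C"]
      by (simp add: subseq_singleton_left)
    then have "ccw a w b" using assms unfolding convex_position_def by simp
    then show ?thesis using ccw_rotate by blast
  qed
qed

text \<open>At a split the line through \<open>a\<close> and \<open>b\<close> separates the two
  halves, so edges from different halves can meet only on this line.\<close>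

lemma plane_drawing_parabola:
  assumes "polygon_triangulation vs E" "convex_position vs"
  shows "plane_drawing parabola_point (set vs) E"
proof -
  let ?h = "\<lambda>e. convex hull (parabola_point ` e)"
  have "?h e \<inter> ?h f \<subseteq> parabola_point ` (e \<inter> f)" if "e \<in> E" "f \<in> E" "e \<noteq> f" for e f
    using assms that
  proof (induction arbitrary: e f rule: polygon_triangulation.induct)
    case (triangle a b c)
    have abc: "ccw a b c" using triangle.prems(1) by (auto simp: convex_position_def)
    \<comment> \<open>The whole segment of \<open>{u, v}\<close> lies on its line, whereas the
      segment of \<open>{v, w}\<close> touches this line only at the common vertex.\<close>
    have *: "?h {u, v} \<inter> ?h {v, w} \<subseteq> {parabola_point v}" if c: "ccw u v w" for u v w
    proof
      fix x assume x: "x \<in> ?h {u, v} \<inter> ?h {v, w}"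
      have "0 \<le> left_of u v x" using hull_left_of[of "{u, v}" u v x] x by simp
      moreover have "0 \<le> left_of v u x" using hull_left_of[of "{u, v}" v u x] x by (simp add: insert_commute)
      ultimately have "left_of u v x = 0" by (simp add: left_of_swap[of v u])
      then have "x \<in> ?h ({v, w} \<inter> {u, v})" using c x by (intro hull_left_of_0) auto
      moreover have "w \<noteq> u" "w \<noteq> v" using c by (auto simp: ccw_def)
      then have "{v, w} \<inter> {u, v} = {v}" by auto
      ultimately show "x \<in> {parabola_point v}" by simp
    qed
    have r: "?h {a, b} \<inter> ?h {b, c} \<subseteq> {parabola_point b}" "?h {b, c} \<inter> ?h {a, c} \<subseteq> {parabola_point c}"
      "?h {a, c} \<inter> ?h {a, b} \<subseteq> {parabola_point a}"
      using *[OF abc] *[OF ccw_rotate[OF abc]] *[OF ccw_rotate[OF ccw_rotate[OF abc]]]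
      by (simp_all add: insert_commute)
    have t: "?h {a, b} \<inter> ?h {b, c} \<subseteq> parabola_point ` ({a, b} \<inter> {b, c})"
      "?h {b, c} \<inter> ?h {a, c} \<subseteq> parabola_point ` ({b, c} \<inter> {a, c})"
      "?h {a, c} \<inter> ?h {a, b} \<subseteq> parabola_point ` ({a, c} \<inter> {a, b})"
      by (rule order.trans[OF r(1)], simp) (rule order.trans[OF r(2)], simp, rule order.trans[OF r(3)], simp)
    note t = t t[unfolded Int_commute[of "?h {a, b}"] Int_commute[of "{a, b}"]]
      t[unfolded Int_commute[of "?h {b, c}"] Int_commute[of "{b, c}"]]
      t[unfolded Int_commute[of "?h {a, c}"] Int_commute[of "{a, c}"]]
    from triangle.prems(2,3) have "e = {a, b} \<or> e = {b, c} \<or> e = {a, c}" "f = {a, b} \<or> f = {b, c} \<or> f = {a, c}"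
      by blast+
    then show ?case using triangle.prems(4) by (elim disjE) (simp_all only: t simp_thms)
  next
    case (split a B b E C F)
    note cp = convex_position_split[OF split.prems(1)]
    note EF = polygon_triangulation_facts(4)[OF split.hyps(1)] polygon_triangulation_facts(4)[OF split.hyps(2)]
    have ab: "{a, b} \<in> E" "{a, b} \<in> F" using polygon_triangulation_Int[OF split.hyps] by auto
    \<comment> \<open>If one of the two edges is the chord itself, both belong to the same half and
      the induction hypothesis applies.\<close>
    have cross: "?h e \<inter> ?h f \<subseteq> parabola_point ` (e \<inter> f)" if e: "e \<in> E" "f \<in> F" "e \<noteq> f" for e f
    proof (cases "e = {a, b} \<or> f = {a, b}")
      case True
      then show ?thesis using split.IH cp(1,2) ab e by blast
    next
      case False
      \<comment> \<open>Any other edge contains at most one of \<open>a\<close> and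
        \<open>b\<close>, so it has at most one vertex, and no further point, on the chord's
        line.\<close>
      have small: "?h (g \<inter> {a, b}) \<subseteq> parabola_point ` (g \<inter> {a, b})" if "card g = 2" "g \<noteq> {a, b}" for g
      proof -
        have "\<not> {a, b} \<subseteq> g"
        proof
          assume "{a, b} \<subseteq> g"
          moreover have "finite g" "card {a, b} = card g" using \<open>card g = 2\<close> split.hyps(3) by (auto intro: card_ge_0_finite)
          ultimately show False using card_subset_eq[of g "{a, b}"] \<open>g \<noteq> {a, b}\<close> by simp
        qed
        then have "g \<inter> {a, b} = {} \<or> g \<inter> {a, b} = {a} \<or> g \<inter> {a, b} = {b}" by auto
        then show ?thesis by (elim disjE) simp_all
      qed
      show ?thesis
      proof
        fix x assume x: "x \<in> ?h e \<inter> ?h f"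
        have s: "w \<in> e - {b, a} \<Longrightarrow> ccw b a w" "w \<in> f - {a, b} \<Longrightarrow> ccw a b w" for w
          using EF(1)[OF e(1)] EF(2)[OF e(2)] cp(3,4)[of w] by auto
        have fin: "finite e" "finite f" using EF(1)[OF e(1)] EF(2)[OF e(2)] by (auto intro: card_ge_0_finite)
        have "0 \<le> left_of b a x" "0 \<le> left_of a b x" using hull_left_of s x by blast+
        then have z: "left_of a b x = 0" "left_of b a x = 0" by (simp_all add: left_of_swap[of b a])
        have "x \<in> ?h (e \<inter> {b, a})" "x \<in> ?h (f \<inter> {a, b})"
          using hull_left_of_0[of e b a x] hull_left_of_0[of f a b x] s x fin z by auto
        then have "x \<in> parabola_point ` (e \<inter> {a, b})" "x \<in> parabola_point ` (f \<inter> {a, b})"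
          using small[of e] small[of f] EF(1)[OF e(1)] EF(2)[OF e(2)] False by (auto simp: insert_commute)
        then show "x \<in> parabola_point ` (e \<inter> f)"
          using inj_parabola_point[of UNIV] by (auto dest: injD)
      qed
    qed
    consider "e \<in> E" "f \<in> E" | "e \<in> F" "f \<in> F" | "e \<in> E" "f \<in> F" | "f \<in> E" "e \<in> F"
      using split.prems(2,3) by blast
    then show ?case
    proof cases
      case 1 then show ?thesis using split.IH(1)[OF cp(1)] split.prems(4) by blast
    next
      case 2 then show ?thesis using split.IH(2)[OF cp(2)] split.prems(4) by blast
    next
      case 3 then show ?thesis using cross split.prems(4) by blast
    next
      case 4
      have "?h f \<inter> ?h e \<subseteq> parabola_point ` (f \<inter> e)" using cross[OF 4] split.prems(4) by simp
      then show ?thesis by (simp only: Int_commute)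
    qed
  next
    case (rotate xs ys E)
    then show ?case using convex_position_rotate by blast
  qed auto
  then show ?thesis unfolding plane_drawing_def using inj_parabola_point by (auto simp: hull_inc)
qed

section \<open>The inside of a convex polygon\<close>

lemma path_edges_decomp: "e \<in> path_edges ws \<Longrightarrow> \<exists>xs u v ys. ws = xs @ u # v # ys \<and> e = {u, v}"
proof (induction ws rule: path_edges.induct)
  case (1 x y zs)
  then show ?case
  proof (cases "e = {x, y}")
    case True then show ?thesis by (metis append_Nil)
  next
    case False
    then obtain xs u v ys where "y # zs = xs @ u # v # ys" "e = {u, v}" using 1 by auto
    then show ?thesis by (intro exI[of _ "x # xs"]) auto
  qed
qed auto

text \<open>Rotating the list until the side \<open>u\<close>, \<open>v\<close> comes first makes
  \<open>[u, v, w]\<close> a subsequence for every other vertex \<open>w\<close>.\<close>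

lemma closed_edges_supporting:
  assumes "convex_position vs" "2 \<le> length vs" "distinct vs" "e \<in> closed_edges vs"
  obtains u v where "e = {u, v}" "u \<noteq> v" "\<And>w. w \<in> set vs - {u, v} \<Longrightarrow> ccw u v w"
proof -
  obtain xs u v ys where *: "vs @ [hd vs] = xs @ u # v # ys" "e = {u, v}"
    using path_edges_decomp[OF assms(4)[unfolded closed_edges_def]] by blast
  have "\<exists>xs' ys' C. vs = xs' @ ys' \<and> ys' @ xs' = u # v # C"
  proof (cases ys rule: rev_cases)
    \<comment> \<open>This is the closing side, from the last vertex back to the first.\<close>
    case Nil
    then have vs: "vs = xs @ [u]" "v = hd vs" using * by auto
    obtain y C where "xs = y # C" using vs(1) assms(2) by (cases xs) auto
    then have "vs = (v # C) @ [u] \<and> [u] @ v # C = u # v # C" using vs by simp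
    then show ?thesis by blast
  next
    case (snoc ys' y)
    then have "vs = xs @ (u # v # ys') \<and> (u # v # ys') @ xs = u # v # (ys' @ xs)" using * by auto
    then show ?thesis by blast
  qed
  then obtain xs' ys' C where r: "vs = xs' @ ys'" "ys' @ xs' = u # v # C" by blast
  then have c: "convex_position (u # v # C)" using assms(1) convex_position_rotate by metis
  have "set vs = set (ys' @ xs')" "distinct (ys' @ xs')" using assms(3) unfolding r(1) by auto
  then have "set vs = set (u # v # C)" "u \<noteq> v" unfolding r(2) by auto
  moreover have "ccw u v w" if "w \<in> set C" for w
    using c that unfolding convex_position_def by (simp add: subseq_singleton_left)
  ultimately show ?thesis using *(2) by (intro that) auto
qed

text \<open>The inside is an open subset of the hull. Conversely, the interior of the hull is
  connected and misses the boundary curve, so it cannot reach from the inside to the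
  outside.\<close>

lemma inside_convex_polygon:
  assumes cp: "convex_position vs" and l: "3 \<le> length vs" and d: "distinct vs"
    and pd: "plane_drawing parabola_point (set vs) (closed_edges vs)"
  shows "inside (segs parabola_point (closed_edges vs)) = interior (convex hull (parabola_point ` set vs))"
    and "interior (convex hull (parabola_point ` set vs)) \<noteq> {}"
    and "connected (inside (segs parabola_point (closed_edges vs)))"
proof -
  let ?J = "segs parabola_point (closed_edges vs)" and ?H = "convex hull (parabola_point ` set vs)"
  obtain g where g: "simple_path g" "pathfinish g = pathstart g" "path_image g = ?J"
    by (rule closed_edges_loop[OF d l pd])
  note J = Jordan_inside_outside[OF g(1,2), unfolded g(3)]
  have JH: "?J \<subseteq> ?H" unfolding segs_def
    by (intro UN_least hull_mono image_mono closed_edges_subset)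
  have compH: "compact ?H" by (intro compact_convex_hull finite_imp_compact finite_imageI) simp
  \<comment> \<open>The complement of the hull is connected, unbounded and disjoint from the curve,
    so it belongs to the outside.\<close>
  have "\<not> bounded (- ?H)"
    using compH compact_imp_bounded[of ?H] bounded_Un[of ?H "- ?H"] not_bounded_UNIV by auto
  moreover have "connected (- ?H)"
    using compH by (intro connected_complement_bounded_convex compact_imp_bounded) auto
  ultimately have "inside ?J \<subseteq> ?H - ?J"
    using JH inside_subset[of "- ?H" "?H - ?J" ?J] by blast
  then have inH: "inside ?J \<subseteq> interior ?H" using J by (intro interior_maximal) auto
  show ne: "interior ?H \<noteq> {}" using J inH by auto
  \<comment> \<open>Interior points lie strictly to the left of the line through any side, points of
    that side do not.\<close>
  have "z \<notin> interior ?H" if zJ: "z \<in> ?J" for z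
  proof
    assume z: "z \<in> interior ?H"
    obtain e where e: "e \<in> closed_edges vs" "z \<in> convex hull (parabola_point ` e)" using zJ by (auto simp: segs_def)
    obtain u v where uv: "e = {u, v}" "u \<noteq> v" "\<And>w. w \<in> set vs - {u, v} \<Longrightarrow> ccw u v w"
      by (rule closed_edges_supporting[OF cp _ d e(1)]) (use l in auto)
    let ?n = "left_normal u v"
    have "?n \<noteq> 0" using uv(2) by (simp add: left_normal_def complex_eq_iff)
    have "?H \<subseteq> {x. ?n \<bullet> x \<ge> ?n \<bullet> parabola_point u}"
    proof
      fix x assume "x \<in> ?H"
      then have "0 \<le> left_of u v x" using hull_left_of[of "set vs" u v x] uv(3) by blast
      then show "x \<in> {x. ?n \<bullet> x \<ge> ?n \<bullet> parabola_point u}" unfolding left_of_inner by simp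
    qed
    then have "interior ?H \<subseteq> {x. ?n \<bullet> x > ?n \<bullet> parabola_point u}"
      using interior_mono interior_halfspace_ge[OF \<open>?n \<noteq> 0\<close>] by metis
    then have "0 < left_of u v z" using z unfolding left_of_inner by auto
    moreover have "0 \<le> left_of v u z" using hull_left_of[of "{u, v}" v u z] e(2) uv(1) by auto
    ultimately show False by (simp add: left_of_swap[of v u])
  qed
  then have disj: "interior ?H \<inter> ?J = {}" by blast
  have conn: "connected (interior ?H)" by (intro convex_connected convex_interior) simp
  have sub: "interior ?H \<subseteq> inside ?J \<union> outside ?J" using disj by (simp add: disjoint_eq_subset_Compl)
  have "inside ?J \<inter> outside ?J \<inter> interior ?H = {}" by (simp add: inside_Int_outside)
  then have "inside ?J \<inter> interior ?H = {} \<or> outside ?J \<inter> interior ?H = {}"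
    using J sub by (intro connectedD[OF conn]) simp_all
  moreover have "inside ?J \<inter> interior ?H \<noteq> {}" using J inH by (simp add: Int_absorb2)
  ultimately have "interior ?H \<subseteq> inside ?J" using sub by blast
  then show "inside ?J = interior ?H" using inH by auto
  show "connected (inside ?J)" using J by simp
qed

text \<open>A supporting line of the hull at a point strictly between the ends of the chord would
  contain both ends. But \<open>B\<close> and \<open>C\<close> have vertices strictly on different
  sides of that line.\<close>

lemma open_chord_interior:
  assumes "\<And>w. w \<in> set B \<Longrightarrow> ccw b a w" "\<And>w. w \<in> set C \<Longrightarrow> ccw a b w" "B \<noteq> []" "C \<noteq> []" "a \<noteq> b"
    and "interior (convex hull (parabola_point ` set (a # B @ b # C))) \<noteq> {}"
  shows "convex hull (parabola_point ` {a, b}) - parabola_point ` {a, b} \<subseteq>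
    interior (convex hull (parabola_point ` set (a # B @ b # C)))"
proof
  let ?P = "parabola_point" and ?H = "convex hull (parabola_point ` set (a # B @ b # C))"
  fix x assume x: "x \<in> convex hull (?P ` {a, b}) - ?P ` {a, b}"
  have "x \<in> open_segment (?P a) (?P b)"
    using x by (auto simp: segment_convex_hull open_segment_def)
  then obtain t where t: "x = (1 - t) *\<^sub>R ?P a + t *\<^sub>R ?P b" "0 < t" "t < 1"
    by (auto simp: in_segment)
  have xH: "x \<in> ?H" using x hull_mono[of "?P ` {a, b}" "?P ` set (a # B @ b # C)" convex] by auto
  show "x \<in> interior ?H"
  proof (rule ccontr)
    assume "x \<notin> interior ?H"
    then have nr: "x \<notin> rel_interior ?H" unfolding rel_interior_nonempty_interior[OF assms(6)] .
    obtain m where m: "m \<noteq> 0" "\<And>y. y \<in> ?H \<Longrightarrow> m \<bullet> x \<le> m \<bullet> y"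
      by (rule supporting_hyperplane_rel_boundary[OF convex_convex_hull xH nr]) (rule that)
    have mem: "?P w \<in> ?H" if "w \<in> set (a # B @ b # C)" for w using that by (intro hull_inc imageI)
    obtain c d where cd: "c \<in> set B" "d \<in> set C" using assms(3,4) by (metis last_in_set)
    have mx: "m \<bullet> x = (1 - t) * (m \<bullet> ?P a) + t * (m \<bullet> ?P b)" by (simp add: t(1) inner_add_right)
    have a: "m \<bullet> x \<le> m \<bullet> ?P a" and b: "m \<bullet> x \<le> m \<bullet> ?P b" using m(2) mem by auto
    have "0 \<le> (1 - t) * (m \<bullet> ?P a - m \<bullet> x)" "0 \<le> t * (m \<bullet> ?P b - m \<bullet> x)" using a b t by auto
    moreover have "(1 - t) * (m \<bullet> ?P a - m \<bullet> x) + t * (m \<bullet> ?P b - m \<bullet> x) = 0"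
      using mx by (simp add: algebra_simps)
    ultimately have "(1 - t) * (m \<bullet> ?P a - m \<bullet> x) = 0" "t * (m \<bullet> ?P b - m \<bullet> x) = 0" by linarith+
    then have ab: "m \<bullet> ?P a = m \<bullet> x" "m \<bullet> ?P b = m \<bullet> x" using t by auto
    \<comment> \<open>Since \<open>m\<close> is orthogonal to the chord, it is a multiple of
      \<open>left_normal a b\<close>; the factor \<open>b - a\<close> comes from both
      coordinates.\<close>
    have "(real b - real a) * (Re m + (real a + real b) * Im m) = 0"
      using ab by (simp add: inner_complex_def parabola_point_def power2_eq_square algebra_simps)
    then have "Re m + (real a + real b) * Im m = 0" using assms(5) by simp
    then have re: "Re m = - ((real a + real b) * Im m)" by linarith
    then have im: "Im m \<noteq> 0" using m(1) by (auto simp: complex_eq_iff)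
    have l: "(real b - real a) * (m \<bullet> ?P w - m \<bullet> x) = Im m * left_of a b (?P w)" for w
      unfolding ab(1)[symmetric] left_of_parabola_point
      by (simp add: inner_complex_def parabola_point_def re power2_eq_square algebra_simps)
    have "0 \<le> m \<bullet> ?P c - m \<bullet> x" "0 \<le> m \<bullet> ?P d - m \<bullet> x" using m(2) mem cd by auto
    \<comment> \<open>Multiplying by the square of \<open>b - a\<close> avoids distinguishing the
      signs of \<open>b - a\<close> and \<open>Im m\<close>: the product equals a positive square
      times a negative number.\<close>
    then have "0 \<le> ((real b - real a) * (real b - real a)) * ((m \<bullet> ?P c - m \<bullet> x) * (m \<bullet> ?P d - m \<bullet> x))"
      by (intro mult_nonneg_nonneg zero_le_square)
    also have "\<dots> = ((real b - real a) * (m \<bullet> ?P c - m \<bullet> x)) * ((real b - real a) * (m \<bullet> ?P d - m \<bullet> x))"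
      by (simp only: ac_simps)
    also have "\<dots> = (Im m * Im m) * (left_of a b (?P c) * left_of a b (?P d))"
      unfolding l by (simp only: ac_simps)
    finally have "0 \<le> (Im m * Im m) * (left_of a b (?P c) * left_of a b (?P d))" .
    moreover have "left_of a b (?P c) < 0"
      using assms(1)[OF cd(1)] unfolding left_of_pos_iff[symmetric] left_of_swap[of b a] by simp
    moreover have "0 < left_of a b (?P d)" using assms(2)[OF cd(2)] unfolding left_of_pos_iff .
    moreover have "0 < Im m * Im m" using im not_real_square_gt_zero by blast
    ultimately show False using mult_neg_pos mult_pos_neg by (metis not_le)
  qed
qed

lemma polygon_triangulation_digon:
  assumes "polygon_triangulation [a, b] E" shows "E = {{a, b}}"
proof -
  note f = polygon_triangulation_facts[OF assms]
  have "e = {a, b}" if "e \<in> E" for e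
    using f(4)[OF that] f(1) by (intro card_subset_eq) auto
  moreover have "{a, b} \<in> E" using f(5) by (simp add: closed_edges_def)
  ultimately show ?thesis by blast
qed

lemma triangulated_polygonD:
  assumes "triangulated_polygon p vs E"
  shows "closed_edges vs \<subseteq> E" "\<And>e. e \<in> E \<Longrightarrow> e \<subseteq> set vs"
    "\<And>e. e \<in> E - closed_edges vs \<Longrightarrow> convex hull (p ` e) - p ` e \<subseteq> inside (segs p (closed_edges vs))"
    "\<And>R. R \<in> components (inside (segs p (closed_edges vs)) - segs p E) \<Longrightarrow>
        \<exists>a b c. {{a, b}, {b, c}, {a, c}} \<subseteq> E \<and> R = interior (convex hull {p a, p b, p c})"
proof -
  note t = assms[unfolded triangulated_polygon_def]
  show "closed_edges vs \<subseteq> E" using t by (elim conjE)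
  have "\<forall>e\<in>E. e \<subseteq> set vs \<and> card e = 2" using t by (elim conjE)
  then show "\<And>e. e \<in> E \<Longrightarrow> e \<subseteq> set vs" by simp
  have "\<forall>e\<in>E - closed_edges vs. convex hull (p ` e) - p ` e \<subseteq> inside (segs p (closed_edges vs))"
    using t by (elim conjE)
  then show "\<And>e. e \<in> E - closed_edges vs \<Longrightarrow> convex hull (p ` e) - p ` e \<subseteq> inside (segs p (closed_edges vs))"
    by (rule bspec)
  have "\<forall>R\<in>components (inside (segs p (closed_edges vs)) - segs p E).
        \<exists>a b c. {{a, b}, {b, c}, {a, c}} \<subseteq> E \<and> R = interior (convex hull {p a, p b, p c})"
    using t by (elim conjE)
  then show "\<And>R. R \<in> components (inside (segs p (closed_edges vs)) - segs p E) \<Longrightarrow>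
        \<exists>a b c. {{a, b}, {b, c}, {a, c}} \<subseteq> E \<and> R = interior (convex hull {p a, p b, p c})"
    by (rule bspec)
qed

text \<open>The recursive structure is kept: \<open>plane_drawing_parabola\<close> excludes
  crossings, \<open>open_chord_interior\<close> puts the cutting chord inside, and
  \<open>components_split\<close> collects the faces of the halves.\<close>

lemma triangulation_imp_triangulated_polygon:
  assumes "polygon_triangulation vs E" "convex_position vs"
  shows "triangulated_polygon parabola_point vs E"
  using assms
proof (induction rule: polygon_triangulation.induct)
  case (digon a b)
  have t: "polygon_triangulation [a, b] {{a, b}}" using digon by (intro polygon_triangulation.digon)
  \<comment> \<open>A digon is drawn as one segment, which is convex and encloses nothing, so it has
    no faces.\<close>
  have "inside (segs parabola_point {{a, b}}) = {}" by (simp add: segs_def inside_convex)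
  then show ?case unfolding triangulated_polygon_def
    using digon plane_drawing_parabola[OF t] by (auto simp: closed_edges_def insert_commute)
next
  case (triangle a b c)
  let ?E = "{{a, b}, {b, c}, {a, c}}"
  have ce: "closed_edges [a, b, c] = ?E" by (auto simp: closed_edges_def)
  have pd: "plane_drawing parabola_point (set [a, b, c]) ?E"
    by (rule plane_drawing_parabola[OF polygon_triangulation.triangle[OF triangle.hyps] triangle.prems])
  note i = inside_convex_polygon[of "[a, b, c]", unfolded ce, OF triangle.prems _ triangle.hyps pd]
  let ?I = "inside (segs parabola_point ?E)"
  have "?I - segs parabola_point ?E = ?I" using inside_no_overlap[of "segs parabola_point ?E"] by blast
  then have "components (?I - segs parabola_point ?E) = {?I}"
    using i components_eq_sing_iff[of ?I] by simp
  moreover have "?I = interior (convex hull {parabola_point a, parabola_point b, parabola_point c})" using i by simp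
  ultimately show ?case unfolding triangulated_polygon_def ce
    using triangle.hyps pd by auto
next
  case (split a B b E C F)
  let ?v = "a # B @ b # C" and ?v1 = "a # B @ [b]" and ?v2 = "b # C @ [a]"
  let ?in = "\<lambda>vs. inside (segs parabola_point (closed_edges vs))"
  note cp = convex_position_split[OF split.prems]
  note t1 = triangulated_polygonD[OF split.IH(1)[OF cp(1)]]
    and t2 = triangulated_polygonD[OF split.IH(2)[OF cp(2)]]
  have ab: "{a, b} \<in> E" "{a, b} \<in> F" using polygon_triangulation_Int[OF split.hyps] by auto
  show ?case
  \<comment> \<open>If one side is empty, that half is a digon and adds only \<open>{a, b}\<close>,
    already an edge of the other half.\<close>
  proof (cases "B = [] \<or> C = []")
    case True
    then show ?thesis
    proof
      assume B: "B = []"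
      then have "E = {{a, b}}" using polygon_triangulation_digon split.hyps(1) by simp
      then have "E \<union> F = F" using ab by auto
      then show ?thesis using split.IH(2)[OF cp(2)] triangulated_polygon_rotate[of parabola_point "[a]" "b # C" F] B by simp
    next
      assume C: "C = []"
      then have "F = {{a, b}}" using polygon_triangulation_digon[of b a F] split.hyps(2) by (simp add: insert_commute)
      then have "E \<union> F = E" using ab by auto
      then show ?thesis using split.IH(1)[OF cp(1)] C by simp
    qed
  next
    case False
    then have BC: "B \<noteq> []" "C \<noteq> []" by auto
    then have l: "3 \<le> length ?v" by (cases B; cases C; simp)
    have t: "polygon_triangulation ?v (E \<union> F)" by (rule polygon_triangulation.split[OF split.hyps])
    note f = polygon_triangulation_facts[OF t]
    have pdE: "plane_drawing parabola_point (set ?v) (E \<union> F)" by (rule plane_drawing_parabola[OF t split.prems])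
    then have pd: "plane_drawing parabola_point (set ?v) (insert {a, b} (closed_edges ?v))"
      by (rule plane_drawing_mono) (use f(5) ab in auto)
    have pdc: "plane_drawing parabola_point (set ?v) (closed_edges ?v)"
      by (rule plane_drawing_mono[OF pd]) auto
    note i = inside_convex_polygon[OF split.prems l split.hyps(3) pdc]
    have o: "convex hull (parabola_point ` {a, b}) - parabola_point ` {a, b} \<subseteq> ?in ?v"
      unfolding i(1) using split.hyps(3) by (intro open_chord_interior cp(3,4) BC i(2)) auto
    have "convex hull (parabola_point ` {a, b}) - parabola_point ` {a, b} \<noteq> {}"
      using split.hyps(3) by (intro open_edge(2) inj_parabola_point) auto
    then have meets: "convex hull (parabola_point ` {a, b}) \<inter> ?in ?v \<noteq> {}" using o by blast
    note sp = inside_split[OF split.hyps(3) BC pd meets]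
    have comp: "components (?in ?v - segs parabola_point (E \<union> F)) =
      components (?in ?v1 - segs parabola_point E) \<union> components (?in ?v2 - segs parabola_point F)"
      by (rule components_split[OF split.hyps(3) BC pd meets t1(1-3) t2(1-3)])
    have chords: "convex hull (parabola_point ` e) - parabola_point ` e \<subseteq> ?in ?v"
      if e: "e \<in> E \<union> F - closed_edges ?v" for e
    proof (cases "e = {a, b}")
      case True then show ?thesis using o by simp
    next
      case False
      then have "e \<notin> closed_edges ?v1" "e \<notin> closed_edges ?v2"
        using e unfolding closed_edges_arc closed_edges_split by (auto simp: insert_commute)
      then have "convex hull (parabola_point ` e) - parabola_point ` e \<subseteq> ?in ?v1 \<union> ?in ?v2"
        using e t1(3)[of e] t2(3)[of e] by blast
      then show ?thesis using sp(2) by blast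
    qed
    show ?thesis unfolding triangulated_polygon_def
    proof (intro conjI ballI)
      fix R assume "R \<in> components (?in ?v - segs parabola_point (E \<union> F))"
      then consider "R \<in> components (?in ?v1 - segs parabola_point E)" | "R \<in> components (?in ?v2 - segs parabola_point F)"
        unfolding comp by blast
      then show "\<exists>a b c. {{a, b}, {b, c}, {a, c}} \<subseteq> E \<union> F \<and>
        R = interior (convex hull {parabola_point a, parabola_point b, parabola_point c})"
      proof cases
        case 1 then show ?thesis using t1(4) by (meson le_supI1)
      next
        case 2 then show ?thesis using t2(4) by (meson le_supI2)
      qed
    qed (use f pdE chords split.hyps(3) in blast)+
  qed
next
  case (rotate xs ys E)
  then show ?case using convex_position_rotate triangulated_polygon_rotate by blast
qed

section \<open>Balanced triangulations\<close>

text \<open>One node of the tree: the triangle on \<open>x\<close>, \<open>y\<close>,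
  \<open>z\<close> carries the two polygons on its sides \<open>{x, y}\<close> and
  \<open>{y, z}\<close> and offers \<open>{x, z}\<close> as the new outer side.\<close>

lemma polygon_triangulation_join:
  assumes E: "polygon_triangulation (x # B @ [y]) E" and F: "polygon_triangulation (y # C @ [z]) F"
    and d: "distinct (x # B @ y # C @ [z])"
  shows "polygon_triangulation (x # B @ y # C @ [z]) (insert {x, z} (E \<union> F))"
proof -
  have "polygon_triangulation (z # [x] @ [y]) {{z, x}, {x, y}, {z, y}}"
    using polygon_triangulation.triangle[of z x y] d by auto
  from polygon_triangulation.split[OF F this]
  have "polygon_triangulation (y # (C @ [z]) @ [x]) (F \<union> {{z, x}, {x, y}, {z, y}})" using d by auto
  from polygon_triangulation.split[OF E this]
  have "polygon_triangulation (x # B @ y # C @ [z]) (E \<union> (F \<union> {{z, x}, {x, y}, {z, y}}))" using d by simp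
  moreover have "{x, y} \<in> E" "{z, y} \<in> F"
    using polygon_triangulation_facts(5)[OF E] polygon_triangulation_facts(5)[OF F]
    unfolding closed_edges_arc by (auto simp: insert_commute)
  then have "E \<union> (F \<union> {{z, x}, {x, y}, {z, y}}) = insert {x, z} (E \<union> F)" by (auto simp: insert_commute)
  ultimately show ?thesis by simp
qed

lemma upt_ends: "i < j \<Longrightarrow> [i..<Suc j] = i # [Suc i..<j] @ [j]"
  using upt_conv_Cons[of i j] by simp

text \<open>Arcs are intervals of numbers relabelled by \<open>g\<close>, so that an arc may end at
  \<open>n\<close>, which stands for vertex \<open>0\<close>. As only an upper bound is wanted,
  overlaps between the edge sets are simply overcounted.\<close>

lemma interval_triangulation_join:
  fixes L :: "'a set \<Rightarrow> nat"
  assumes "i < m" "m < j" "inj_on g {i..j}"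
    and E: "polygon_triangulation (map g [i..<Suc m]) E" and F: "polygon_triangulation (map g [m..<Suc j]) F"
  obtains G where "polygon_triangulation (map g [i..<Suc j]) G" "sum L G \<le> L {g i, g j} + sum L E + sum L F"
proof -
  have "[Suc i..<j] = [Suc i..<m] @ m # [Suc m..<j]"
    using assms(1,2) upt_add_eq_append[of "Suc i" m "j - m"] upt_conv_Cons[of m j] by simp
  then have l: "map g [i..<Suc j] = g i # map g [Suc i..<m] @ g m # map g [Suc m..<j] @ [g j]"
    using assms(1,2) upt_ends[of i j] by (simp del: upt_Suc)
  have "distinct (map g [i..<Suc j])"
    using assms(3) by (simp add: distinct_map atLeastLessThanSuc_atLeastAtMost del: upt_Suc)
  then have "polygon_triangulation (map g [i..<Suc j]) (insert {g i, g j} (E \<union> F))"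
    using polygon_triangulation_join[of "g i" "map g [Suc i..<m]" "g m" E "map g [Suc m..<j]" "g j" F]
      E F assms(1,2) upt_ends[of i m] upt_ends[of m j] unfolding l by (simp del: upt_Suc)
  moreover have "sum L (insert {g i, g j} (E \<union> F)) \<le> L {g i, g j} + sum L E + sum L F"
  proof -
    have fin: "finite E" "finite F" using polygon_triangulation_facts(2) E F by auto
    have "sum L (insert {g i, g j} (E \<union> F)) \<le> L {g i, g j} + sum L (E \<union> F)"
      using fin by (simp add: sum.insert_if)
    also have "sum L (E \<union> F) \<le> sum L E + sum L F"
      using sum.union_inter[OF fin, of L] by linarith
    finally show ?thesis by simp
  qed
  ultimately show ?thesis by (rule that)
qed

text \<open>Halving an arc of length between \<open>2 ^ (q + 1)\<close> and
  \<open>2 ^ (q + 2)\<close> gives two of length between \<open>2 ^ q\<close> and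
  \<open>2 ^ (q + 1)\<close>, and the costs obey the recursion that produced the lines in
  \<open>tree_cost_ge\<close>. Here these lines are thus attained.\<close>

lemma balanced_triangulation:
  fixes L :: "'a set \<Rightarrow> nat"
  assumes "2 ^ q \<le> j - i" "j - i \<le> 2 ^ (q + 1)" "inj_on g {i..j}"
    and "\<And>u v. i \<le> u \<Longrightarrow> u < v \<Longrightarrow> v \<le> j \<Longrightarrow> L {g u, g v} \<le> v - u"
  shows "\<exists>E. polygon_triangulation (map g [i..<Suc j]) E \<and> sum L E + 2 ^ (q + 1) \<le> (j - i) * (q + 3)"
  using assms
proof (induction q arbitrary: i j)
  case 0
  have digon: "polygon_triangulation (map g [u..<Suc (Suc u)]) {{g u, g (Suc u)}} \<and> L {g u, g (Suc u)} \<le> 1"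
    if "i \<le> u" "u < j" for u
  proof -
    have "g u \<noteq> g (Suc u)" using inj_onD[OF "0.prems"(3), of u "Suc u"] that by auto
    then show ?thesis using polygon_triangulation.digon[of "g u" "g (Suc u)"] "0.prems"(4)[of u "Suc u"] that by simp
  qed
  \<comment> \<open>For \<open>q = 0\<close> the arc is a single edge or a pair of edges under one
    root of length at most \<open>2\<close>.\<close>
  consider "j = Suc i" | "j = Suc (Suc i)" using "0.prems"(1,2) by force
  then show ?case
  proof cases
    case 1
    then show ?thesis using digon[of i] by (intro exI[of _ "{{g i, g j}}"]) auto
  next
    case 2
    have i: "i < Suc i" "Suc i < j" using 2 by auto
    obtain G where "polygon_triangulation (map g [i..<Suc j]) G"
      "sum L G \<le> L {g i, g j} + sum L {{g i, g (Suc i)}} + sum L {{g (Suc i), g j}}"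
      by (rule interval_triangulation_join[OF i "0.prems"(3), of "{{g i, g (Suc i)}}" "{{g (Suc i), g j}}" L])
        (use digon[of i] digon[of "Suc i"] 2 in auto)
    moreover have "L {g i, g j} \<le> 2" using "0.prems"(4)[of i j] 2 by simp
    ultimately show ?thesis using digon[of i] digon[of "Suc i"] 2 by (intro exI[of _ G]) auto
  qed
next
  case (Suc q)
  define s where "s = j - i"
  define m where "m = i + s div 2"
  have s: "2 * 2 ^ q \<le> s" "s \<le> 4 * 2 ^ q" using Suc.prems(1,2) by (auto simp: s_def)
  have pos: "1 \<le> (2::nat) ^ q" by simp
  have ij: "i < m" "m < j" using s pos unfolding m_def s_def by linarith+
  have h: "m - i = s div 2" "j - m = s - s div 2" using ij by (auto simp: m_def s_def)
  have "\<exists>E. polygon_triangulation (map g [i..<Suc m]) E \<and> sum L E + 2 ^ (q + 1) \<le> (m - i) * (q + 3)"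
  proof (rule Suc.IH)
    show "2 ^ q \<le> m - i" "m - i \<le> 2 ^ (q + 1)" unfolding h using s by auto
    show "inj_on g {i..m}" using ij by (intro inj_on_subset[OF Suc.prems(3)]) auto
    show "L {g u, g v} \<le> v - u" if "i \<le> u" "u < v" "v \<le> m" for u v using that ij Suc.prems(4) by simp
  qed
  then obtain E where E: "polygon_triangulation (map g [i..<Suc m]) E" "sum L E + 2 ^ (q + 1) \<le> (m - i) * (q + 3)" by blast
  have "\<exists>E. polygon_triangulation (map g [m..<Suc j]) E \<and> sum L E + 2 ^ (q + 1) \<le> (j - m) * (q + 3)"
  proof (rule Suc.IH)
    show "2 ^ q \<le> j - m" "j - m \<le> 2 ^ (q + 1)" unfolding h using s by auto
    show "inj_on g {m..j}" using ij by (intro inj_on_subset[OF Suc.prems(3)]) auto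
    show "L {g u, g v} \<le> v - u" if "m \<le> u" "u < v" "v \<le> j" for u v using that ij Suc.prems(4) by simp
  qed
  then obtain F where F: "polygon_triangulation (map g [m..<Suc j]) F" "sum L F + 2 ^ (q + 1) \<le> (j - m) * (q + 3)" by blast
  obtain G where G: "polygon_triangulation (map g [i..<Suc j]) G" "sum L G \<le> L {g i, g j} + sum L E + sum L F"
    by (rule interval_triangulation_join[OF ij Suc.prems(3) E(1) F(1)])
  have "L {g i, g j} \<le> j - i" using Suc.prems(4)[of i j] ij by simp
  then have "sum L G + 2 ^ (Suc q + 1) \<le> (j - i) + (m - i) * (q + 3) + (j - m) * (q + 3)"
    using G(2) E(2) F(2) by simp
  also have "\<dots> = (j - i) + ((m - i) + (j - m)) * (q + 3)" by (simp only: add_mult_distrib add.assoc)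
  also have "(m - i) + (j - m) = j - i" using ij by simp
  also have "(j - i) + (j - i) * (q + 3) = (j - i) * (Suc q + 3)"
    using mult_Suc_right[of "j - i" "q + 3"] by simp
  finally show ?case using G(1) by blast
qed

lemma chord_length_mod_le:
  assumes "u < v" "v \<le> n" shows "chord_length n {u mod n, v mod n} \<le> v - u"
proof -
  have "gap n (u mod n) (v mod n) \<le> v - u"
    using assms by (cases "v = n") (auto simp: gap_eq)
  moreover have "u mod n < n" "v mod n < n" using assms by auto
  ultimately show ?thesis by (simp add: chord_length_eq)
qed

text \<open>The central triangle has vertices \<open>0\<close>, \<open>a\<close>, \<open>b\<close>;
  the range of \<open>n\<close> is what keeps the three arcs between \<open>2 ^ k\<close> and
  \<open>2 ^ (k + 1)\<close>.\<close>

lemma optimal_triangulation: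
  fixes k n :: nat
  assumes "3 * 2 ^ k \<le> n" "n \<le> 3 * 2 ^ (k + 1)"
  obtains E where "polygon_triangulation [0..<n] E"
    "(\<Sum>e\<in>E. chord_length n e) + 3 * 2 ^ (k + 1) \<le> n * (k + 3)"
proof -
  define g where "g i = i mod n" for i
  \<comment> \<open>The first arc takes a third, rounded down; the rest has length between
    \<open>2 * 2 ^ k\<close> and \<open>4 * 2 ^ k\<close> and is halved.\<close>
  define a where "a = n div 3"
  define b where "b = (n - a) div 2 + a"
  have pos: "1 \<le> (2::nat) ^ k" by simp
  have len: "2 ^ k \<le> a - 0" "a - 0 \<le> 2 ^ (k + 1)" "2 ^ k \<le> b - a" "b - a \<le> 2 ^ (k + 1)"
    "2 ^ k \<le> n - b" "n - b \<le> 2 ^ (k + 1)"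
  proof -
    define c where "c = (n - a) div 2"
    have a: "3 * a \<le> n" "n < 3 * a + 3" unfolding a_def by presburger+
    have c: "2 * c \<le> n - a" "n - a < 2 * c + 2" unfolding c_def by presburger+
    have b: "b - a = c" "n - b = n - a - c" unfolding b_def c_def by simp_all
    have "2 * 2 ^ k \<le> n - a" "n - a \<le> 4 * 2 ^ k" using a assms by simp_all
    then have "2 ^ k \<le> c" "c \<le> 2 * 2 ^ k" "2 ^ k \<le> n - a - c" "n - a - c \<le> 2 * 2 ^ k"
      using c by linarith+
    moreover have "2 ^ k \<le> a" "a \<le> 2 * 2 ^ k" using a assms by simp_all
    ultimately show "2 ^ k \<le> a - 0" "a - 0 \<le> 2 ^ (k + 1)" "2 ^ k \<le> b - a" "b - a \<le> 2 ^ (k + 1)"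
      "2 ^ k \<le> n - b" "n - b \<le> 2 ^ (k + 1)" unfolding b by simp_all
  qed
  have ab: "0 < a" "a < b" "b < n" using len pos by linarith+
  have id: "inj_on g A" if "A \<subseteq> {..<n}" for A
    using that by (auto simp: inj_on_def g_def subset_iff)
  have inj: "inj_on g {0..b}" "inj_on g {0..a}" "inj_on g {a..b}" using ab by (intro id; auto)+
  \<comment> \<open>Only \<open>n\<close> is mapped to \<open>0\<close>, because
    \<open>b > 0\<close>.\<close>
  have inj3: "inj_on g {b..n}"
  proof (rule inj_onI)
    fix x y assume "x \<in> {b..n}" "y \<in> {b..n}" "g x = g y"
    then show "x = y" using ab by (cases "x = n"; cases "y = n") (auto simp: g_def)
  qed
  let ?L = "chord_length n"
  have L: "?L {g u, g v} \<le> v - u" if "u < v" "v \<le> n" for u v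
    using chord_length_mod_le[OF that] by (simp add: g_def)
  obtain E1 where E1: "polygon_triangulation (map g [0..<Suc a]) E1" "sum ?L E1 + 2 ^ (k + 1) \<le> (a - 0) * (k + 3)"
    using balanced_triangulation[OF len(1,2) inj(2), of ?L] L ab by auto
  obtain E2 where E2: "polygon_triangulation (map g [a..<Suc b]) E2" "sum ?L E2 + 2 ^ (k + 1) \<le> (b - a) * (k + 3)"
    using balanced_triangulation[OF len(3,4) inj(3), of ?L] L ab by auto
  obtain E3 where E3: "polygon_triangulation (map g [b..<Suc n]) E3" "sum ?L E3 + 2 ^ (k + 1) \<le> (n - b) * (k + 3)"
    using balanced_triangulation[OF len(5,6) inj3, of ?L] L ab by auto
  have g: "g 0 = 0" "g n = 0" "g a = a" "g b = b" "map g [Suc 0..<b] = [Suc 0..<b]" "map g [Suc b..<n] = [Suc b..<n]"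
    using ab by (auto simp: g_def intro!: map_idI)
  \<comment> \<open>Joining over \<open>a\<close> inserts the central triangle; its side
    \<open>{0, b}\<close> is the closing side of the third arc's polygon.\<close>
  obtain E' where E': "polygon_triangulation (map g [0..<Suc b]) E'" "sum ?L E' \<le> ?L {g 0, g b} + sum ?L E1 + sum ?L E2"
    by (rule interval_triangulation_join[OF ab(1,2) inj(1) E1(1) E2(1)])
  have t: "polygon_triangulation (0 # [Suc 0..<b] @ [b]) E'" "polygon_triangulation (b # [Suc b..<n] @ [0]) E3"
    using E'(1) E3(1) upt_ends[of 0 b] upt_ends[of b n] g ab by (simp_all del: upt_Suc)
  have l: "0 # [Suc 0..<b] @ b # [Suc b..<n] = [0..<n]"
    using ab upt_conv_Cons[of b n] upt_conv_Cons[of 0 n] upt_add_eq_append[of "Suc 0" b "n - b"] by simp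
  have d: "distinct (0 # [Suc 0..<b] @ b # [Suc b..<n])" unfolding l by simp
  have E: "polygon_triangulation [0..<n] (E' \<union> E3)"
    using polygon_triangulation.split[OF t d] unfolding l .
  \<comment> \<open>The edge \<open>{0, b}\<close> is counted in both parts, which cancels the extra
    summand \<open>?L {g 0, g b}\<close> from the join.\<close>
  have "E' \<inter> E3 = {{0, b}}" by (rule polygon_triangulation_Int[OF t d])
  then have "sum ?L (E' \<union> E3) + ?L {0, b} = sum ?L E' + sum ?L E3"
    using sum.union_inter[of E' E3 ?L] polygon_triangulation_facts(2)[OF t(1)] polygon_triangulation_facts(2)[OF t(2)] by simp
  then have "sum ?L (E' \<union> E3) \<le> sum ?L E1 + sum ?L E2 + sum ?L E3" using E'(2) g by simp
  then have "sum ?L (E' \<union> E3) + 3 * 2 ^ (k + 1) \<le> (a - 0) * (k + 3) + (b - a) * (k + 3) + (n - b) * (k + 3)"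
    using E1(2) E2(2) E3(2) by simp
  also have "\<dots> = ((a - 0) + (b - a) + (n - b)) * (k + 3)" by (simp only: add_mult_distrib)
  also have "(a - 0) + (b - a) + (n - b) = n" using ab by simp
  finally show ?thesis using that[OF E] by simp
qed

lemma convex_position_upt: "convex_position [0..<n]"
  unfolding convex_position_def
proof (intro allI impI)
  fix x y z assume "subseq [x, y, z] [0..<n]"
  then obtain N where "[x, y, z] = nths [0..<n] N" by (auto simp: subseq_conv_nths)
  then have "sorted [x, y, z]" "distinct [x, y, z]"
    using sorted_nths[of "[0..<n]" N] distinct_nthsI[of "[0..<n]" N] by simp_all
  then show "ccw x y z" by (intro ccw_less) auto
qed

theorem theorem1:
  fixes k n :: nat
  assumes "3 * 2 ^ k \<le> n" and "n \<le> 3 * 2 ^ (k + 1)"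
  shows "(\<exists>p D. maximal_outerplanar n p D \<and>
            int (TCL n D) = int n * (int k + 2) - 3 * 2 ^ (k + 1)) \<and>
         (\<forall>p D. maximal_outerplanar n p D \<longrightarrow>
            int n * (int k + 2) - 3 * 2 ^ (k + 1) \<le> int (TCL n D))"
proof (intro conjI allI impI)
  obtain E where E: "polygon_triangulation [0..<n] E"
    "(\<Sum>e\<in>E. chord_length n e) + 3 * 2 ^ (k + 1) \<le> n * (k + 3)"
    by (rule optimal_triangulation[OF assms])
  have "(1::nat) \<le> 2 ^ k" by simp
  then have n: "3 \<le> n" using assms(1) by linarith
  define D where "D = E - cycle_edges n"
  have cE: "cycle_edges n \<subseteq> E" using polygon_triangulation_facts(5)[OF E(1)] by (simp add: closed_edges_upt)
  then have ED: "cycle_edges n \<union> D = E" by (auto simp: D_def)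
  have "triangulated_polygon parabola_point [0..<n] E"
    by (rule triangulation_imp_triangulated_polygon[OF E(1) convex_position_upt])
  then have m: "maximal_outerplanar n parabola_point D"
    unfolding maximal_outerplanar_iff ED using n by (auto simp: D_def)
  have "TCL n D + n + 3 * 2 ^ (k + 1) \<le> n * (k + 3)"
    using E(2) sum_chord_length_eq_TCL[OF n polygon_triangulation_facts(2)[OF E(1)] cE] by (simp add: D_def)
  then have "int (TCL n D + n + 3 * 2 ^ (k + 1)) \<le> int (n * (k + 3))" by (simp only: of_nat_le_iff)
  then have "int (TCL n D) \<le> int n * (int k + 2) - 3 * 2 ^ (k + 1)" by (simp add: algebra_simps)
  then show "\<exists>p D. maximal_outerplanar n p D \<and> int (TCL n D) = int n * (int k + 2) - 3 * 2 ^ (k + 1)"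
    using m maximal_outerplanar_TCL_ge[OF m, of k] by (intro exI[of _ parabola_point] exI[of _ D]) simp
qed (rule maximal_outerplanar_TCL_ge)

end
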